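(* Let $V$ be a finite-dimensional $k$-vector space and let $A$ be an associative unital $k$-algebra. (i) Let $V_A = V\otimes A$ be the right free $A$-module, made into an $A$-bimodule by a left module structure given by a commutation rule $\Lambda: A\to A\otimes \mathrm{End}\,V$. Then its right $A$-dual $(V_A)^\dagger = {}_A\tilde V = A\otimes\tilde V$ is a left free $A$-bimodule whose right module structure is given by the transpose (right) commutation rule $\Phi=\tilde\Lambda$; that is, in dual bases, $(1\otimes e^k).a=\Lambda^k_m(a)\otimes e^m$ for all $a\in A$. (ii) Assume further that $A$ is a bialgebra and that $V_A$ is a right $A$-covariant bimodule generated by a representation $\lambda:A\to\mathrm{End}\,V$, i.e. $\Lambda(a)=\lambda(a_{(1)})\,a_{(2)}$, so that $a.(v\otimes b)=\lambda(a_{(1)})v\otimes a_{(2)}b$. Then its right $A$-dual ${}_A\tilde V$ is a left (free) $A^{\mathrm{cop}}$-covariant bimodule generated by $(\tilde V,\tilde\lambda)$; that is, its right multiplication is $(b\otimes\alpha).a=b\,a_{(2)}\otimes\tilde\lambda(a_{(1)})\alpha$, and together with the free left $A^{\mathrm{cop}}$-coaction $\triangle(b\otimes\alpha)=b_{(2)}\otimes b_{(1)}\otimes\alpha$ it is a left $A^{\mathrm{cop}}$-covariant bimodule.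
   Context: $k$ is a field; tensor products are over $k$. $\tilde V=\mathrm{Hom}(V,k)$; $\{e_i\}$ is a basis of $V$, $\{e^i\}$ the dual basis of $\tilde V$; repeated upper and lower indices are summed. Sweedler notation: $\triangle(a)=a_{(1)}\otimes a_{(2)}$. $A^{\mathrm{cop}}$ is the bialgebra with the same algebra structure as $A$ and comultiplication $a\mapsto a_{(2)}\otimes a_{(1)}$. $V_A=V\otimes A$ and ${}_A\tilde V=A\otimes\tilde V$ are the free right, respectively left, $A$-modules (with multiplication in $A$). A commutation rule is a unital algebra map $\Lambda:A\to A\otimes\mathrm{End}\,V$, with components $\Lambda^i_k:A\to A$ satisfying $\Lambda^i_k(1)=\delta^i_k$ and $\Lambda^i_k(ab)=\Lambda^i_m(a)\Lambda^m_k(b)$. It gives a left multiplication on $V_A$ determined by $a.(e_k\otimes 1)=e_i\otimes\Lambda^i_k(a)$, and makes $V_A$ an $A$-bimodule (every left structure making $V_A$ a bimodule arises in this way). Similarly, a right multiplication on a left free module ${}_AW=A\otimes W$ is described by a right commutation rule $\Phi$ via $(1\otimes w_k).a=\Phi^i_k(a)\otimes w_i$ in a basis $\{w_i\}$ of $W$. The transpose $\tilde\Lambda$ is obtained from $\Lambda$ by transposing the $\mathrm{End}\,V$ factor. For an $A$-bimodule $N$, the right $A$-dual $N^\dagger=\mathrm{Hom}_{(-,A)}(N,A)$ is the space of right $A$-module maps $N\to A$ with the bimodule structure $(a.Y.b)(y)=a\,Y(b.y)$. The identification $(V_A)^\dagger={}_A\tilde V$ is via the pairing $\langle\!\langle a\otimes\alpha,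 v\otimes b\rangle\!\rangle=ab\,\alpha(v)$. For a representation $\lambda$ of $A$ on $V$, $\tilde\lambda(a)\in\mathrm{End}\,\tilde V$ is the transpose of $\lambda(a)$; it is a right $A$-module structure on $\tilde V$. For a bialgebra $B$: a right $B$-covariant (free) bimodule structure on $V_B$ is a $B$-bimodule structure on the free right module $V_B$ whose free right coaction $\mathrm{id}\otimes\triangle: V_B\to V_B\otimes B$ satisfies $\triangle(a.x.b)=\triangle(a)\triangle(x)\triangle(b)$. A left $B$-covariant (free) bimodule structure on ${}_BW$ is a $B$-bimodule structure on the free left module $B\otimes W$ whose free left coaction $\triangle\otimes\mathrm{id}$ satisfies the same identity in $B\otimes {}_BW$. *)

theory Defs
  imports Complex_Main "HOL-Library.Function_Algebras"
begin

section \<open>Vector spaces over a field, with carriers\<close>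

text \<open>
  The spaces \<open>V\<close> and \<open>A\<close> of the theorem are whole types, equipped with a scalar multiplication
  satisfying \<^locale>\<open>vector_space\<close>. Hom-spaces and tensor products depend on these scalar
  multiplications and hence are not types; they are subspaces of function types, with pointwise
  addition. The following record covers both cases.
\<close>

record ('k, 'b) vspace =
  vcarrier :: "'b set"
  vscale :: "'k \<Rightarrow> 'b \<Rightarrow> 'b"

definition vspace :: "('k::field, 'b::ab_group_add) vspace \<Rightarrow> bool" where
  "vspace E \<longleftrightarrow> vector_space (vscale E) \<and> module.subspace (vscale E) (vcarrier E)"

definition whole :: "('k \<Rightarrow> 'b \<Rightarrow> 'b) \<Rightarrow> ('k, 'b) vspace" where
  "whole s = \<lparr>vcarrier = UNIV, vscale = s\<rparr>"

definition linear_on ::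
  "('k::field, 'b::ab_group_add) vspace \<Rightarrow> ('k, 'c::ab_group_add) vspace \<Rightarrow> ('b \<Rightarrow> 'c) \<Rightarrow> bool" where
  "linear_on E F f \<longleftrightarrow>
     (\<forall>x\<in>vcarrier E. f x \<in> vcarrier F) \<and>
     (\<forall>x\<in>vcarrier E. \<forall>y\<in>vcarrier E. f (x + y) = f x + f y) \<and>
     (\<forall>c. \<forall>x\<in>vcarrier E. f (vscale E c x) = vscale F c (f x))"

definition bilinear_on ::
  "('k::field, 'b::ab_group_add) vspace \<Rightarrow> ('k, 'c::ab_group_add) vspace \<Rightarrow>
   ('k, 'd::ab_group_add) vspace \<Rightarrow> ('b \<Rightarrow> 'c \<Rightarrow> 'd) \<Rightarrow> bool" where
  "bilinear_on E F X f \<longleftrightarrow>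
     (\<forall>x\<in>vcarrier E. linear_on F X (f x)) \<and>
     (\<forall>y\<in>vcarrier F. linear_on E X (\<lambda>x. f x y))"

text \<open>Linear maps are normalised to be \<open>0\<close> outside the carrier, so that equality of functions is
  equality of maps.\<close>

definition hom_space ::
  "('k::field, 'b::ab_group_add) vspace \<Rightarrow> ('k, 'c::ab_group_add) vspace \<Rightarrow> ('k, 'b \<Rightarrow> 'c) vspace" where
  "hom_space E F =
     \<lparr>vcarrier = {f. linear_on E F f \<and> (\<forall>x. x \<notin> vcarrier E \<longrightarrow> f x = 0)},
      vscale = (\<lambda>c f x. vscale F c (f x))\<rparr>"

abbreviation End_space ::
  "('k::field, 'b::ab_group_add) vspace \<Rightarrow> ('k, 'b \<Rightarrow> 'b) vspace" where
  "End_space E \<equiv> hom_space E E"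

definition End_one :: "('k::field, 'b::ab_group_add) vspace \<Rightarrow> 'b \<Rightarrow> 'b" where
  "End_one E = (\<lambda>x. if x \<in> vcarrier E then x else 0)"

definition dual_space ::
  "('k::field, 'b::ab_group_add) vspace \<Rightarrow> ('k, 'b \<Rightarrow> 'k) vspace" where
  "dual_space E = hom_space E (whole (*))"

text \<open>The transpose of an endomorphism of \<open>E\<close>, an endomorphism of the dual space.\<close>

definition transpose_map ::
  "('k::field, 'b::ab_group_add) vspace \<Rightarrow> ('b \<Rightarrow> 'b) \<Rightarrow> ('b \<Rightarrow> 'k) \<Rightarrow> ('b \<Rightarrow> 'k)" where
  "transpose_map E T = (\<lambda>\<alpha>. if \<alpha> \<in> vcarrier (dual_space E) then \<alpha> \<circ> T else 0)"

text \<open>The dual basis vector \<open>e\<^sup>i\<close> is the coordinate functional belonging to \<open>e\<^sub>i\<close>.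
  Bases are indexed by themselves: \<open>i\<close> stands for \<open>e\<^sub>i\<close>.\<close>

definition dual_basis ::
  "('k::field \<Rightarrow> 'v::ab_group_add \<Rightarrow> 'v) \<Rightarrow> 'v set \<Rightarrow> 'v \<Rightarrow> ('v \<Rightarrow> 'k)" where
  "dual_basis s B i = (\<lambda>v. module.representation s B v i)"


section \<open>Tensor products over the ground field\<close>

text \<open>
  The pure tensor of \<open>v\<close> and \<open>w\<close> is the evaluation \<open>\<beta> \<mapsto> \<beta> v w\<close> on bilinear forms, and
  the tensor product is the span of the pure tensors. Over a field this is a tensor
  product, as the lemmas \<open>tensor_lift_pure\<close>, \<open>tensor_lift_linear\<close> and \<open>tensor_lift_unique\<close>
  below show: every bilinear map factors uniquely through a linear map.
\<close>

definition pure ::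
  "('k::field, 'b::ab_group_add) vspace \<Rightarrow> ('k, 'c::ab_group_add) vspace \<Rightarrow>
   'b \<Rightarrow> 'c \<Rightarrow> (('b \<Rightarrow> 'c \<Rightarrow> 'k) \<Rightarrow> 'k)" where
  "pure E F v w = (\<lambda>\<beta>. if bilinear_on E F (whole (*)) \<beta> then \<beta> v w else 0)"

definition tensor ::
  "('k::field, 'b::ab_group_add) vspace \<Rightarrow> ('k, 'c::ab_group_add) vspace \<Rightarrow>
   ('k, ('b \<Rightarrow> 'c \<Rightarrow> 'k) \<Rightarrow> 'k) vspace" where
  "tensor E F =
     \<lparr>vcarrier = module.span (\<lambda>c t \<beta>. c * t \<beta>)
        {pure E F v w | v w. v \<in> vcarrier E \<and> w \<in> vcarrier F},
      vscale = (\<lambda>c t \<beta>. c * t \<beta>)\<rparr>"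

text \<open>The linear map on the tensor product induced by a bilinear map \<open>f\<close>.\<close>

definition tensor_lift ::
  "('k::field, 'b::ab_group_add) vspace \<Rightarrow> ('k, 'c::ab_group_add) vspace \<Rightarrow>
   ('b \<Rightarrow> 'c \<Rightarrow> 'd::ab_group_add) \<Rightarrow> (('b \<Rightarrow> 'c \<Rightarrow> 'k) \<Rightarrow> 'k) \<Rightarrow> 'd" where
  "tensor_lift E F f t =
     (THE x. \<exists>(n::nat) v w. (\<forall>i<n. v i \<in> vcarrier E \<and> w i \<in> vcarrier F) \<and>
        t = (\<Sum>i<n. pure E F (v i) (w i)) \<and> x = (\<Sum>i<n. f (v i) (w i)))"

text \<open>The product \<open>(a \<otimes> b, c \<otimes> d) \<mapsto> f a c \<otimes> g b d\<close> from \<open>E \<otimes> F\<close> and \<open>G \<otimes> H\<close> to \<open>X \<otimes> Y\<close>.\<close>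

definition tensor_product_map where
  "tensor_product_map E F G H X Y f g x y =
     tensor_lift E F (\<lambda>a b. tensor_lift G H (\<lambda>c d. pure X Y (f a c) (g b d)) y) x"


subsection \<open>The universal property\<close>

lemma vspace_add: "vspace E \<Longrightarrow> x \<in> vcarrier E \<Longrightarrow> y \<in> vcarrier E \<Longrightarrow> x + y \<in> vcarrier E"
  unfolding vspace_def
  by (metis module_iff_vector_space module.subspace_add)

lemma vspace_scale: "vspace E \<Longrightarrow> x \<in> vcarrier E \<Longrightarrow> vscale E c x \<in> vcarrier E"
  unfolding vspace_def
  by (metis module_iff_vector_space module.subspace_scale)

lemma vspace_zero: "vspace E \<Longrightarrow> 0 \<in> vcarrier E"
  unfolding vspace_def
  by (metis module_iff_vector_space module.subspace_0)

lemma vspace_sum: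
  "vspace E \<Longrightarrow> (\<And>i. i \<in> I \<Longrightarrow> f i \<in> vcarrier E) \<Longrightarrow> sum f I \<in> vcarrier E"
  unfolding vspace_def
  by (metis module_iff_vector_space module.subspace_sum)

lemma vspace_whole: "vector_space s \<Longrightarrow> vspace (whole s)"
  unfolding vspace_def whole_def
  by (simp add: module_iff_vector_space module.subspace_UNIV)

lemma linear_on_0:
  assumes "vspace E" "linear_on E F f" shows "f 0 = 0"
proof -
  have "f (0 + 0) = f 0 + f 0"
    using assms vspace_zero[OF assms(1)] unfolding linear_on_def by blast
  then show ?thesis by simp
qed

lemma linear_on_sum:
  assumes "vspace E" "linear_on E F f" "\<And>i. i \<in> I \<Longrightarrow> x i \<in> vcarrier E"
  shows "f (sum x I) = (\<Sum>i\<in>I. f (x i))"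
  using assms(3)
proof (induction I rule: infinite_finite_induct)
  case (insert i I)
  have "sum x I \<in> vcarrier E" using insert.prems by (intro vspace_sum[OF assms(1)]) auto
  moreover have "x i \<in> vcarrier E" using insert.prems by auto
  ultimately have "f (x i + sum x I) = f (x i) + f (sum x I)"
    using assms(2) unfolding linear_on_def by blast
  then show ?case using insert by simp
qed (simp_all add: linear_on_0[OF assms(1,2)])

lemma vector_space_pointwise: "vector_space (\<lambda>(c::'k::field) (t :: 'b \<Rightarrow> 'k) \<beta>. c * t \<beta>)"
  by unfold_locales (auto simp: fun_eq_iff algebra_simps)

lemma vspace_tensor:
  fixes E :: "('k::field, 'b::ab_group_add) vspace" and F :: "('k, 'c::ab_group_add) vspace"
  shows "vspace (tensor E F)"
proof -
  interpret vector_space "\<lambda>(c::'k) (t :: ('b \<Rightarrow> 'c \<Rightarrow> 'k) \<Rightarrow> 'k) \<beta>. c * t \<beta>"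
    by (rule vector_space_pointwise)
  show ?thesis
    unfolding vspace_def tensor_def using vector_space_axioms subspace_span by simp
qed

lemma pure_in_tensor:
  fixes E :: "('k::field, 'b::ab_group_add) vspace" and F :: "('k, 'c::ab_group_add) vspace"
  assumes "v \<in> vcarrier E" "w \<in> vcarrier F"
  shows "pure E F v w \<in> vcarrier (tensor E F)"
proof -
  interpret vector_space "\<lambda>(c::'k) (t :: ('b \<Rightarrow> 'c \<Rightarrow> 'k) \<Rightarrow> 'k) \<beta>. c * t \<beta>"
    by (rule vector_space_pointwise)
  show ?thesis using assms unfolding tensor_def by (auto intro!: span_base)
qed

lemma bilinear_on_pure: "bilinear_on E F (tensor E F) (pure E F)"
proof -
  have add: "pure E F (x + y) z = pure E F x z + pure E F y z"
    if "x \<in> vcarrier E" "y \<in> vcarrier E" "z \<in> vcarrier F" for x y z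
    using that by (auto simp: pure_def bilinear_on_def linear_on_def fun_eq_iff)
  have add': "pure E F z (x + y) = pure E F z x + pure E F z y"
    if "x \<in> vcarrier F" "y \<in> vcarrier F" "z \<in> vcarrier E" for x y z
    using that by (auto simp: pure_def bilinear_on_def linear_on_def fun_eq_iff)
  have sc: "pure E F (vscale E c x) z = vscale (tensor E F) c (pure E F x z)"
    if "x \<in> vcarrier E" "z \<in> vcarrier F" for x z c
    using that
    by (auto simp: pure_def tensor_def bilinear_on_def linear_on_def fun_eq_iff whole_def)
  have sc': "pure E F z (vscale F c x) = vscale (tensor E F) c (pure E F z x)"
    if "x \<in> vcarrier F" "z \<in> vcarrier E" for x z c
    using that
    by (auto simp: pure_def tensor_def bilinear_on_def linear_on_def fun_eq_iff whole_def)
  show ?thesis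
    unfolding bilinear_on_def linear_on_def
    using add add' sc sc' pure_in_tensor by blast
qed

lemma tensor_representation:
  fixes E :: "('k::field, 'b::ab_group_add) vspace" and F :: "('k, 'c::ab_group_add) vspace"
  assumes "vspace E" and "t \<in> vcarrier (tensor E F)"
  obtains n :: nat and v w where "\<And>i. i < n \<Longrightarrow> v i \<in> vcarrier E"
    "\<And>i. i < n \<Longrightarrow> w i \<in> vcarrier F" "t = (\<Sum>i<n. pure E F (v i) (w i))"
proof -
  interpret vector_space "\<lambda>(c::'k) (t :: ('b \<Rightarrow> 'c \<Rightarrow> 'k) \<Rightarrow> 'k) \<beta>. c * t \<beta>"
    by (rule vector_space_pointwise)
  let ?P = "{pure E F v w | v w. v \<in> vcarrier E \<and> w \<in> vcarrier F}"
  have "t \<in> span ?P" using assms(2) by (simp add: tensor_def)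
  then have "\<exists>(n::nat) v w. (\<forall>i<n. v i \<in> vcarrier E \<and> w i \<in> vcarrier F) \<and>
        t = (\<Sum>i<n. pure E F (v i) (w i))"
  proof (induction rule: span_induct_alt)
    case base
    show ?case by (intro exI[of _ "0::nat"]) simp
  next
    case (step c x y)
    from step obtain n v w where
      *: "\<forall>i<n. v i \<in> vcarrier E \<and> w i \<in> vcarrier F" "y = (\<Sum>i<(n::nat). pure E F (v i) (w i))"
      by blast
    from step obtain a b where ab: "a \<in> vcarrier E" "b \<in> vcarrier F" "x = pure E F a b" by blast
    have cx: "(\<lambda>\<beta>. c * x \<beta>) = pure E F (vscale E c a) b"
      using bilinear_on_pure[of E F] ab
      by (simp add: bilinear_on_def linear_on_def tensor_def)
    let ?v = "v(n := vscale E c a)" and ?w = "w(n := b)"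
    have "(\<lambda>\<beta>. c * x \<beta>) + y = (\<Sum>i<Suc n. pure E F (?v i) (?w i))"
      using * cx by simp
    moreover have "\<forall>i<Suc n. ?v i \<in> vcarrier E \<and> ?w i \<in> vcarrier F"
      using * ab vspace_scale[OF assms(1)] by (auto simp: less_Suc_eq)
    ultimately show ?case by blast
  qed
  then show ?thesis using that by blast
qed

lemma separating_functional:
  assumes "vector_space s" "x \<noteq> 0"
  obtains \<phi> where "Vector_Spaces.linear s (*) \<phi>" "\<phi> x \<noteq> (0::'k::field)"
proof -
  interpret vector_space s by fact
  interpret K: vector_space "(*) :: 'k \<Rightarrow> 'k \<Rightarrow> 'k" by unfold_locales (auto simp: algebra_simps)
  interpret vector_space_pair s "(*) :: 'k \<Rightarrow> 'k \<Rightarrow> 'k" ..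
  have "independent {x}" using assms(2) by simp
  from linear_independent_extend[OF this, of "\<lambda>_. 1"] show ?thesis using that by force
qed

lemma tensor_sum_well_defined:
  fixes f :: "'b::ab_group_add \<Rightarrow> 'c::ab_group_add \<Rightarrow> 'd::ab_group_add"
    and E :: "('k::field, 'b) vspace"
  assumes X: "vspace X" and f: "bilinear_on E F X f"
    and 1: "\<And>i. i < n \<Longrightarrow> v i \<in> vcarrier E \<and> w i \<in> vcarrier F"
    and 2: "\<And>i. i < m \<Longrightarrow> v' i \<in> vcarrier E \<and> w' i \<in> vcarrier F"
    and eq: "(\<Sum>i<(n::nat). pure E F (v i) (w i)) = (\<Sum>i<(m::nat). pure E F (v' i) (w' i))"
  shows "(\<Sum>i<n. f (v i) (w i)) = (\<Sum>i<m. f (v' i) (w' i))"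
proof (rule ccontr)
  let ?x = "(\<Sum>i<n. f (v i) (w i)) - (\<Sum>i<m. f (v' i) (w' i))"
  assume "\<not> ?thesis"
  then have "?x \<noteq> 0" by simp
  moreover have vsX: "vector_space (vscale X)" using X by (simp add: vspace_def)
  ultimately obtain \<phi> where phi: "Vector_Spaces.linear (vscale X) (*) \<phi>" "\<phi> ?x \<noteq> (0::'k)"
    by (meson separating_functional)
  interpret phi: Vector_Spaces.linear "vscale X" "(*)" \<phi> by fact
  have bil: "bilinear_on E F (whole (*)) (\<lambda>a b. \<phi> (f a b))"
    using f unfolding bilinear_on_def linear_on_def whole_def
    by (auto simp: phi.add phi.scale)
  have ev: "(\<Sum>i<l. pure E F (p i) (q i)) (\<lambda>a b. \<phi> (f a b)) = (\<Sum>i<l. \<phi> (f (p i) (q i)))"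
    for l :: nat and p q
    by (induction l) (simp_all add: pure_def bil)
  have "(\<Sum>i<n. \<phi> (f (v i) (w i))) = (\<Sum>i<m. \<phi> (f (v' i) (w' i)))"
    using eq ev[of v w n] ev[of v' w' m] by simp
  then have "\<phi> ?x = 0" by (simp add: phi.diff phi.sum)
  then show False using phi(2) by simp
qed

lemma tensor_lift_sum:
  fixes n :: nat
  assumes "vspace X" "bilinear_on E F X f"
    and "\<And>i. i < n \<Longrightarrow> v i \<in> vcarrier E" "\<And>i. i < n \<Longrightarrow> w i \<in> vcarrier F"
  shows "tensor_lift E F f (\<Sum>i<n. pure E F (v i) (w i)) = (\<Sum>i<n. f (v i) (w i))"
  unfolding tensor_lift_def
proof (rule the_equality)
  show "\<exists>(na::nat) va wa. (\<forall>i<na. va i \<in> vcarrier E \<and> wa i \<in> vcarrier F) \<and>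
     (\<Sum>i<n. pure E F (v i) (w i)) = (\<Sum>i<na. pure E F (va i) (wa i)) \<and>
     (\<Sum>i<n. f (v i) (w i)) = (\<Sum>i<na. f (va i) (wa i))"
    by (intro exI[of _ n] exI[of _ v] exI[of _ w]) (simp add: assms(3,4))
next
  fix x
  assume "\<exists>(na::nat) va wa. (\<forall>i<na. va i \<in> vcarrier E \<and> wa i \<in> vcarrier F) \<and>
     (\<Sum>i<n. pure E F (v i) (w i)) = (\<Sum>i<na. pure E F (va i) (wa i)) \<and>
     x = (\<Sum>i<na. f (va i) (wa i))"
  then obtain m v' w' where *: "\<forall>i<m. v' i \<in> vcarrier E \<and> w' i \<in> vcarrier F"
    "(\<Sum>i<n. pure E F (v i) (w i)) = (\<Sum>i<m. pure E F (v' i) (w' i))"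
    "x = (\<Sum>i<(m::nat). f (v' i) (w' i))" by blast
  from tensor_sum_well_defined[OF assms(1,2) _ _ *(2)] assms(3,4) *(1,3)
  show "x = (\<Sum>i<n. f (v i) (w i))" by simp
qed

lemma tensor_lift_pure:
  assumes "vspace X" "bilinear_on E F X f" "v \<in> vcarrier E" "w \<in> vcarrier F"
  shows "tensor_lift E F f (pure E F v w) = f v w"
  using tensor_lift_sum[OF assms(1,2), of 1 "\<lambda>_. v" "\<lambda>_. w"] assms(3,4) by simp

lemma tensor_lift_linear:
  fixes E :: "('k::field, 'b::ab_group_add) vspace" and F :: "('k, 'c::ab_group_add) vspace"
    and X :: "('k, 'd::ab_group_add) vspace"
  assumes E: "vspace E" and X: "vspace X" and f: "bilinear_on E F X f"
  shows "linear_on (tensor E F) X (tensor_lift E F f)"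
proof -
  have vsX: "vector_space (vscale X)" using X by (simp add: vspace_def)
  interpret X: vector_space "vscale X" by fact
  interpret T: vector_space "\<lambda>(c::'k) (t :: ('b \<Rightarrow> 'c \<Rightarrow> 'k) \<Rightarrow> 'k) \<beta>. c * t \<beta>"
    by (rule vector_space_pointwise)
  have fX: "f a b \<in> vcarrier X" if "a \<in> vcarrier E" "b \<in> vcarrier F" for a b
    using f that by (simp add: bilinear_on_def linear_on_def)
  show ?thesis
    unfolding linear_on_def
  proof (intro conjI ballI allI)
    fix s assume s: "s \<in> vcarrier (tensor E F)"
    obtain n :: nat and v w where vw: "\<And>i. i < n \<Longrightarrow> v i \<in> vcarrier E"
      "\<And>i. i < n \<Longrightarrow> w i \<in> vcarrier F" "s = (\<Sum>i<n. pure E F (v i) (w i))"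
      using tensor_representation[OF E s] by blast
    have ls: "tensor_lift E F f s = (\<Sum>i<n. f (v i) (w i))"
      using tensor_lift_sum[OF X f] vw by simp
    show "tensor_lift E F f s \<in> vcarrier X"
      unfolding ls by (rule vspace_sum[OF X]) (simp add: fX vw)
    show "tensor_lift E F f (vscale (tensor E F) c s) = vscale X c (tensor_lift E F f s)" for c
    proof -
      have "vscale (tensor E F) c s = (\<Sum>i<n. vscale (tensor E F) c (pure E F (v i) (w i)))"
        unfolding tensor_def vspace.simps vw(3) by (rule T.scale_sum_right)
      also have "\<dots> = (\<Sum>i<n. pure E F (vscale E c (v i)) (w i))"
        using bilinear_on_pure[of E F] vw by (simp add: bilinear_on_def linear_on_def)
      finally have "tensor_lift E F f (vscale (tensor E F) c s)
          = (\<Sum>i<n. f (vscale E c (v i)) (w i))"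
        using tensor_lift_sum[OF X f, of n "\<lambda>i. vscale E c (v i)" w] vw vspace_scale[OF E] by simp
      also have "\<dots> = (\<Sum>i<n. vscale X c (f (v i) (w i)))"
        using f vw by (simp add: bilinear_on_def linear_on_def)
      also have "\<dots> = vscale X c (\<Sum>i<n. f (v i) (w i))" by (rule X.scale_sum_right[symmetric])
      finally show ?thesis by (simp add: ls)
    qed
    fix t assume t: "t \<in> vcarrier (tensor E F)"
    obtain m :: nat and v' w' where vw': "\<And>i. i < m \<Longrightarrow> v' i \<in> vcarrier E"
      "\<And>i. i < m \<Longrightarrow> w' i \<in> vcarrier F" "t = (\<Sum>i<m. pure E F (v' i) (w' i))"
      using tensor_representation[OF E t] by blast
    have lt: "tensor_lift E F f t = (\<Sum>i<m. f (v' i) (w' i))"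
      using tensor_lift_sum[OF X f] vw' by simp
    let ?p = "\<lambda>i. if i < n then v i else v' (i - n)" and ?q = "\<lambda>i. if i < n then w i else w' (i - n)"
    have split: "(\<Sum>i<n+m. g (?p i) (?q i)) = (\<Sum>i<n. g (v i) (w i)) + (\<Sum>i<m. g (v' i) (w' i))"
      for g :: "'b \<Rightarrow> 'c \<Rightarrow> 'e::ab_group_add"
      by (induction m) (simp_all add: add.assoc)
    have "s + t = (\<Sum>i<n+m. pure E F (?p i) (?q i))"
      unfolding split vw(3) vw'(3) by simp
    then have "tensor_lift E F f (s + t) = (\<Sum>i<n+m. f (?p i) (?q i))"
      using tensor_lift_sum[OF X f, of "n+m" ?p ?q] vw vw' by simp
    then show "tensor_lift E F f (s + t) = tensor_lift E F f s + tensor_lift E F f t"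
      unfolding split ls lt by simp
  qed
qed

lemma tensor_lift_unique:
  assumes E: "vspace E" and X: "vspace X" and g: "linear_on (tensor E F) X g"
    and gf: "\<And>v w. v \<in> vcarrier E \<Longrightarrow> w \<in> vcarrier F \<Longrightarrow> g (pure E F v w) = f v w"
    and f: "bilinear_on E F X f" and t: "t \<in> vcarrier (tensor E F)"
  shows "g t = tensor_lift E F f t"
proof -
  obtain n :: nat and v w where vw: "\<And>i. i < n \<Longrightarrow> v i \<in> vcarrier E"
    "\<And>i. i < n \<Longrightarrow> w i \<in> vcarrier F" "t = (\<Sum>i<n. pure E F (v i) (w i))"
    using tensor_representation[OF E t] by blast
  have "g t = (\<Sum>i<n. g (pure E F (v i) (w i)))"
    unfolding vw(3) by (rule linear_on_sum[OF vspace_tensor g]) (simp add: vw pure_in_tensor)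
  then show ?thesis
    using tensor_lift_sum[OF X f] vw gf by simp
qed


section \<open>Algebras, bimodules, commutation rules\<close>

text \<open>The sort \<open>{ring, monoid_mult}\<close> (rather than \<^class>\<open>ring_1\<close>) does not exclude the zero
  algebra.\<close>

locale k_algebra = vector_space sA
  for sA :: "'k::field \<Rightarrow> 'a::{ring,monoid_mult} \<Rightarrow> 'a" +
  assumes scale_mult_left: "sA c x * y = sA c (x * y)"
    and scale_mult_right: "x * sA c y = sA c (x * y)"

locale bimodule = k_algebra sA
  for sA :: "'k::field \<Rightarrow> 'a::{ring,monoid_mult} \<Rightarrow> 'a"
    and N :: "('k, 'n::ab_group_add) vspace"
    and l :: "'a \<Rightarrow> 'n \<Rightarrow> 'n" and r :: "'n \<Rightarrow> 'a \<Rightarrow> 'n" +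
  assumes vspace_N: "vspace N"
    and bilinear_l: "bilinear_on (whole sA) N N l"
    and bilinear_r: "bilinear_on N (whole sA) N r"
    and l_one: "x \<in> vcarrier N \<Longrightarrow> l 1 x = x"
    and l_mult: "x \<in> vcarrier N \<Longrightarrow> l (a * b) x = l a (l b x)"
    and r_one: "x \<in> vcarrier N \<Longrightarrow> r x 1 = x"
    and r_mult: "x \<in> vcarrier N \<Longrightarrow> r x (a * b) = r (r x a) b"
    and l_r: "x \<in> vcarrier N \<Longrightarrow> r (l a x) b = l a (r x b)"

definition bimodule_iso ::
  "('k::field, 'n::ab_group_add) vspace \<Rightarrow> ('a \<Rightarrow> 'n \<Rightarrow> 'n) \<Rightarrow> ('n \<Rightarrow> 'a \<Rightarrow> 'n) \<Rightarrow>
   ('k, 'm::ab_group_add) vspace \<Rightarrow> ('a \<Rightarrow> 'm \<Rightarrow> 'm) \<Rightarrow> ('m \<Rightarrow> 'a \<Rightarrow> 'm) \<Rightarrow> ('n \<Rightarrow> 'm) \<Rightarrow> bool" where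
  "bimodule_iso N l r M l' r' \<theta> \<longleftrightarrow>
     linear_on N M \<theta> \<and> bij_betw \<theta> (vcarrier N) (vcarrier M) \<and>
     (\<forall>a. \<forall>x\<in>vcarrier N. \<theta> (l a x) = l' a (\<theta> x)) \<and>
     (\<forall>a. \<forall>x\<in>vcarrier N. \<theta> (r x a) = r' (\<theta> x) a)"

definition right_free ::
  "('k::field \<Rightarrow> 'a::{ring,monoid_mult} \<Rightarrow> 'a) \<Rightarrow> ('k, 'v::ab_group_add) vspace \<Rightarrow>
   ('k, ('v \<Rightarrow> 'a \<Rightarrow> 'k) \<Rightarrow> 'k) vspace" where
  "right_free sA V = tensor V (whole sA)"

definition right_free_mult where
  "right_free_mult sA V x b =
     tensor_lift V (whole sA) (\<lambda>v c. pure V (whole sA) v (c * b)) x"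

definition left_free ::
  "('k::field \<Rightarrow> 'a::{ring,monoid_mult} \<Rightarrow> 'a) \<Rightarrow> ('k, 'w::ab_group_add) vspace \<Rightarrow>
   ('k, ('a \<Rightarrow> 'w \<Rightarrow> 'k) \<Rightarrow> 'k) vspace" where
  "left_free sA W = tensor (whole sA) W"

definition left_free_mult where
  "left_free_mult sA W a x =
     tensor_lift (whole sA) W (\<lambda>b w. pure (whole sA) W (a * b) w) x"

text \<open>A commutation rule is a unital algebra map from \<open>A\<close> to \<open>A \<otimes> End V\<close>. Writing
  \<open>\<Lambda> a = \<Sum> c \<otimes> T\<close>, the left multiplication is \<open>a.(v \<otimes> b) = \<Sum> T v \<otimes> c b\<close>.\<close>

definition commutation_rule where
  "commutation_rule sA V \<Lambda> \<longleftrightarrow>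
     linear_on (whole sA) (tensor (whole sA) (End_space V)) \<Lambda> \<and>
     \<Lambda> 1 = pure (whole sA) (End_space V) 1 (End_one V) \<and>
     (\<forall>a b. \<Lambda> (a * b) =
        tensor_product_map (whole sA) (End_space V) (whole sA) (End_space V)
          (whole sA) (End_space V) (*) (\<circ>) (\<Lambda> a) (\<Lambda> b))"

definition commutation_left_mult where
  "commutation_left_mult sA V \<Lambda> a x =
     tensor_lift (whole sA) (End_space V)
       (\<lambda>c T. tensor_lift V (whole sA) (\<lambda>v b. pure V (whole sA) (T v) (c * b)) x) (\<Lambda> a)"

text \<open>For a right commutation rule \<open>\<Phi> a = \<Sum> c \<otimes> T\<close>, the right multiplication is
  \<open>(b \<otimes> w).a = \<Sum> b c \<otimes> T w\<close>. The order of composition is therefore reversed: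
  \<open>\<Phi>\<^sup>m\<^sub>k(a b) = \<Phi>\<^sup>i\<^sub>k(a) \<Phi>\<^sup>m\<^sub>i(b)\<close>.\<close>

definition right_commutation_rule where
  "right_commutation_rule sA W \<Phi> \<longleftrightarrow>
     linear_on (whole sA) (tensor (whole sA) (End_space W)) \<Phi> \<and>
     \<Phi> 1 = pure (whole sA) (End_space W) 1 (End_one W) \<and>
     (\<forall>a b. \<Phi> (a * b) =
        tensor_product_map (whole sA) (End_space W) (whole sA) (End_space W)
          (whole sA) (End_space W) (*) (\<lambda>S T. T \<circ> S) (\<Phi> a) (\<Phi> b))"

definition commutation_right_mult where
  "commutation_right_mult sA W \<Phi> x a =
     tensor_lift (whole sA) W
       (\<lambda>b w. tensor_lift (whole sA) (End_space W) (\<lambda>c T. pure (whole sA) W (b * c) (T w)) (\<Phi> a)) x"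

definition transpose_rule where
  "transpose_rule sA V \<Lambda> a =
     tensor_lift (whole sA) (End_space V)
       (\<lambda>c T. pure (whole sA) (End_space (dual_space V)) c (transpose_map V T)) (\<Lambda> a)"

text \<open>The component \<open>\<Lambda>\<^sup>i\<^sub>k(a)\<close>: apply \<open>T \<mapsto> e\<^sup>i(T e\<^sub>k)\<close> to the second factor of \<open>\<Lambda> a\<close>.\<close>

definition component where
  "component sV sA B \<Lambda> i k a =
     tensor_lift (whole sA) (End_space (whole sV)) (\<lambda>c T. sA (dual_basis sV B i (T k)) c) (\<Lambda> a)"


lemma vspace_hom_space:
  fixes E :: "('k::field, 'b::ab_group_add) vspace" and F :: "('k, 'c::ab_group_add) vspace"
  assumes E: "vspace E" and F: "vspace F"
  shows "vspace (hom_space E F)"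
proof -
  interpret F: vector_space "vscale F" using F by (simp add: vspace_def)
  interpret H: vector_space "\<lambda>c (f :: 'b \<Rightarrow> 'c) x. vscale F c (f x)"
    by unfold_locales (auto simp: fun_eq_iff F.scale_right_distrib F.scale_left_distrib)
  have "H.subspace (vcarrier (hom_space E F))"
    unfolding H.subspace_def hom_space_def linear_on_def
    by (auto simp: vspace_add[OF F] vspace_scale[OF F] vspace_zero[OF F] algebra_simps)
  then show ?thesis
    using H.vector_space_axioms by (simp add: vspace_def hom_space_def)
qed

lemma bilinear_on_cong:
  assumes "vspace E" "vspace F" "bilinear_on E F X f"
    and "\<And>x y. x \<in> vcarrier E \<Longrightarrow> y \<in> vcarrier F \<Longrightarrow> g x y = f x y"
  shows "bilinear_on E F X g"
  using assms(3,4) vspace_add[OF assms(1)] vspace_add[OF assms(2)]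
    vspace_scale[OF assms(1)] vspace_scale[OF assms(2)]
  by (simp add: bilinear_on_def linear_on_def)

text \<open>The left multiplication given by \<open>\<Lambda>\<close> is the one determined by
  \<open>a.(e\<^sub>k \<otimes> 1) = e\<^sub>i \<otimes> \<Lambda>\<^sup>i\<^sub>k(a)\<close>.\<close>

lemma commutation_left_mult_basis:
  fixes sV :: "'k::field \<Rightarrow> 'v::ab_group_add \<Rightarrow> 'v"
    and sA :: "'k \<Rightarrow> 'a::{ring,monoid_mult} \<Rightarrow> 'a"
  assumes fd: "finite_dimensional_vector_space sV B" and A: "k_algebra sA"
    and \<Lambda>: "commutation_rule sA (whole sV) \<Lambda>" and k: "k \<in> B"
  shows "commutation_left_mult sA (whole sV) \<Lambda> a (pure (whole sV) (whole sA) k 1) =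
    (\<Sum>i\<in>B. pure (whole sV) (whole sA) i (component sV sA B \<Lambda> i k a))"
proof -
  interpret V: finite_dimensional_vector_space sV B by fact
  interpret A: k_algebra sA by fact
  let ?V = "whole sV" and ?A = "whole sA"
  let ?E = "End_space ?V"
  have vV: "vspace ?V" and vA: "vspace ?A"
    by (simp_all add: vspace_whole V.vector_space_axioms A.vector_space_axioms)
  have vE: "vspace ?E" by (rule vspace_hom_space[OF vV vV])
  have car[simp]: "vcarrier ?V = UNIV" "vcarrier ?A = UNIV" "vscale ?V = sV" "vscale ?A = sA"
    by (simp_all add: whole_def)
  let ?p = "pure ?V ?A"
  have pure1: "?p (x + y) c = ?p x c + ?p y c" "?p x (c + d) = ?p x c + ?p x d"
    "?p (sV u x) c = vscale (tensor ?V ?A) u (?p x c)"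
    "?p x (sA u c) = vscale (tensor ?V ?A) u (?p x c)" for x y c d u
    using bilinear_on_pure[of ?V ?A] by (simp_all add: bilinear_on_def linear_on_def)
  have pc: "?p x c \<in> vcarrier (tensor ?V ?A)" for x c by (simp add: pure_in_tensor)
  have inner: "tensor_lift ?V ?A (\<lambda>v b. ?p (T v) (c * b)) (?p k 1) = ?p (T k) c"
    if "T \<in> vcarrier ?E" for T c
  proof -
    have "bilinear_on ?V ?A (tensor ?V ?A) (\<lambda>v b. ?p (T v) (c * b))"
      using that
      by (auto simp: bilinear_on_def linear_on_def hom_space_def pure1 pc distrib_left
          A.scale_mult_right)
    from tensor_lift_pure[OF vspace_tensor this, of k 1] show ?thesis by simp
  qed
  have bil: "bilinear_on ?A ?E (tensor ?V ?A)
      (\<lambda>c T. tensor_lift ?V ?A (\<lambda>v b. ?p (T v) (c * b)) (?p k 1))"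
  proof (rule bilinear_on_cong[OF vA vE _ inner])
    show "bilinear_on ?A ?E (tensor ?V ?A) (\<lambda>c T. ?p (T k) c)"
      by (auto simp: bilinear_on_def linear_on_def hom_space_def pure1 pc)
  qed auto
  have bilc: "bilinear_on ?A ?E ?A (\<lambda>c T. sA (dual_basis sV B i (T k)) c)" for i
    by (auto simp: bilinear_on_def linear_on_def hom_space_def dual_basis_def
        V.representation_add V.representation_scale V.independent_Basis V.span_Basis
        A.scale_right_distrib A.scale_left_distrib mult.commute)
  have "\<Lambda> a \<in> vcarrier (tensor ?A ?E)"
    using \<Lambda> by (simp add: commutation_rule_def linear_on_def)
  then have "\<exists>(n::nat) c T. (\<forall>j<n. T j \<in> vcarrier ?E) \<and> \<Lambda> a = (\<Sum>j<n. pure ?A ?E (c j) (T j))"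
    by (rule tensor_representation[OF vA]) auto
  then obtain n :: nat and c T where cT: "\<And>j. j < n \<Longrightarrow> T j \<in> vcarrier ?E"
    "\<Lambda> a = (\<Sum>j<n. pure ?A ?E (c j) (T j))"
    by auto
  have comp: "component sV sA B \<Lambda> i k a = (\<Sum>j<n. sA (dual_basis sV B i (T j k)) (c j))" for i
    unfolding component_def cT(2) by (rule tensor_lift_sum[OF vA bilc]) (simp_all add: cT)
  have psum1: "?p (sum f I) d = (\<Sum>i\<in>I. ?p (f i) d)" for f :: "'v \<Rightarrow> 'v" and I d
    using bilinear_on_pure[of ?V ?A]
    by (intro linear_on_sum[OF vV, of "tensor ?V ?A" "\<lambda>x. ?p x d"]) (auto simp: bilinear_on_def)
  have psum2: "?p x (sum f I) = (\<Sum>i\<in>I. ?p x (f i))" for f :: "nat \<Rightarrow> 'a" and I x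
    using bilinear_on_pure[of ?V ?A]
    by (intro linear_on_sum[OF vA, of "tensor ?V ?A"]) (auto simp: bilinear_on_def)
  have "commutation_left_mult sA ?V \<Lambda> a (?p k 1) =
      (\<Sum>j<n. tensor_lift ?V ?A (\<lambda>v b. ?p (T j v) (c j * b)) (?p k 1))"
    unfolding commutation_left_mult_def cT(2)
    by (rule tensor_lift_sum[OF vspace_tensor bil]) (simp_all add: cT)
  also have "\<dots> = (\<Sum>j<n. ?p (T j k) (c j))" by (simp add: inner cT(1))
  also have "\<dots> = (\<Sum>j<n. ?p (\<Sum>i\<in>B. sV (dual_basis sV B i (T j k)) i) (c j))"
    using V.sum_representation_eq[OF V.independent_Basis _ V.finite_Basis subset_refl]
    by (simp add: dual_basis_def V.span_Basis)
  also have "\<dots> = (\<Sum>j<n. \<Sum>i\<in>B. ?p i (sA (dual_basis sV B i (T j k)) (c j)))"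
    by (simp add: psum1 pure1)
  also have "\<dots> = (\<Sum>i\<in>B. \<Sum>j<n. ?p i (sA (dual_basis sV B i (T j k)) (c j)))"
    by (rule sum.swap)
  also have "\<dots> = (\<Sum>i\<in>B. ?p i (component sV sA B \<Lambda> i k a))" by (simp add: comp psum2)
  finally show ?thesis .
qed


subsection \<open>The right dual\<close>

text \<open>Right module maps are again normalised to be \<open>0\<close> outside the carrier.\<close>

definition right_dual ::
  "('k::field \<Rightarrow> 'a::{ring,monoid_mult} \<Rightarrow> 'a) \<Rightarrow> ('k, 'n::ab_group_add) vspace \<Rightarrow>
   ('n \<Rightarrow> 'a \<Rightarrow> 'n) \<Rightarrow> ('k, 'n \<Rightarrow> 'a) vspace" where
  "right_dual sA N r =
     \<lparr>vcarrier = {Y. (\<forall>x\<in>vcarrier N. \<forall>y\<in>vcarrier N. Y (x + y) = Y x + Y y) \<and>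
        (\<forall>x\<in>vcarrier N. \<forall>a. Y (r x a) = Y x * a) \<and> (\<forall>x. x \<notin> vcarrier N \<longrightarrow> Y x = 0)},
      vscale = (\<lambda>c Y x. sA c (Y x))\<rparr>"

definition right_dual_left_mult ::
  "'a::{ring,monoid_mult} \<Rightarrow> ('n \<Rightarrow> 'a) \<Rightarrow> ('n \<Rightarrow> 'a)" where
  "right_dual_left_mult a Y = (\<lambda>y. a * Y y)"

definition right_dual_right_mult ::
  "('k, 'n) vspace \<Rightarrow> ('a \<Rightarrow> 'n \<Rightarrow> 'n) \<Rightarrow> ('n \<Rightarrow> 'a::{ring,monoid_mult}) \<Rightarrow> 'a \<Rightarrow> ('n \<Rightarrow> 'a)" where
  "right_dual_right_mult N l Y b = (\<lambda>y. if y \<in> vcarrier N then Y (l b y) else 0)"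

text \<open>The pairing \<open>\<langle>\<langle>a \<otimes> \<alpha>, v \<otimes> b\<rangle>\<rangle> = a b \<alpha>(v)\<close>, as a map from \<open>A \<otimes> dual_space V\<close> to the
  right dual of \<open>V \<otimes> A\<close>.\<close>

definition dual_pairing where
  "dual_pairing sA V x =
     (\<lambda>y. if y \<in> vcarrier (right_free sA V)
          then tensor_lift (whole sA) (dual_space V)
                 (\<lambda>a \<alpha>. tensor_lift V (whole sA) (\<lambda>v b. sA (\<alpha> v) (a * b)) y) x
          else 0)"


section \<open>Bialgebras and covariant bimodules\<close>

text \<open>\<open>sweedler sA \<Delta> a f\<close> is the Sweedler sum \<open>f(a\<^sub>1, a\<^sub>2)\<close> for bilinear \<open>f\<close>.\<close>

definition sweedler where
  "sweedler sA \<Delta> a f = tensor_lift (whole sA) (whole sA) f (\<Delta> a)"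

locale bialgebra = k_algebra sA
  for sA :: "'k::field \<Rightarrow> 'a::{ring,monoid_mult} \<Rightarrow> 'a"
    and \<Delta> :: "'a \<Rightarrow> (('a \<Rightarrow> 'a \<Rightarrow> 'k) \<Rightarrow> 'k)" and \<epsilon> :: "'a \<Rightarrow> 'k" +
  assumes comult_linear: "linear_on (whole sA) (tensor (whole sA) (whole sA)) \<Delta>"
    and counit_linear: "linear_on (whole sA) (whole (*)) \<epsilon>"
    and coassoc:
      "sweedler sA \<Delta> a (\<lambda>x y. sweedler sA \<Delta> x (\<lambda>u v.
         pure (whole sA) (tensor (whole sA) (whole sA)) u (pure (whole sA) (whole sA) v y))) =
       sweedler sA \<Delta> a (\<lambda>x y. sweedler sA \<Delta> y (\<lambda>u v.
         pure (whole sA) (tensor (whole sA) (whole sA)) x (pure (whole sA) (whole sA) u v)))"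
    and counit_left: "sweedler sA \<Delta> a (\<lambda>x y. sA (\<epsilon> x) y) = a"
    and counit_right: "sweedler sA \<Delta> a (\<lambda>x y. sA (\<epsilon> y) x) = a"
    and comult_one: "\<Delta> 1 = pure (whole sA) (whole sA) 1 1"
    and comult_mult:
      "\<Delta> (a * b) = tensor_product_map (whole sA) (whole sA) (whole sA) (whole sA)
         (whole sA) (whole sA) (*) (*) (\<Delta> a) (\<Delta> b)"
    and counit_one: "\<epsilon> 1 = 1"
    and counit_mult: "\<epsilon> (a * b) = \<epsilon> a * \<epsilon> b"

definition cop where
  "cop sA \<Delta> a = sweedler sA \<Delta> a (\<lambda>x y. pure (whole sA) (whole sA) y x)"

definition representation where
  "representation sA V \<rho> \<longleftrightarrow>
     linear_on (whole sA) (End_space V) \<rho> \<and> \<rho> 1 = End_one V \<and>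
     (\<forall>a b. \<rho> (a * b) = \<rho> a \<circ> \<rho> b)"

text \<open>A right module structure on \<open>W\<close>, with \<open>w.a\<close> written as \<open>\<mu> a w\<close>.\<close>

definition right_module_structure where
  "right_module_structure sA W \<mu> \<longleftrightarrow>
     linear_on (whole sA) (End_space W) \<mu> \<and> \<mu> 1 = End_one W \<and>
     (\<forall>a b. \<mu> (a * b) = \<mu> b \<circ> \<mu> a)"

definition right_coaction where
  "right_coaction sA \<Delta> V x =
     tensor_lift V (whole sA) (\<lambda>v b. sweedler sA \<Delta> b (\<lambda>b1 b2.
       pure (right_free sA V) (whole sA) (pure V (whole sA) v b1) b2)) x"

definition left_coaction where
  "left_coaction sA \<Delta> W x =
     tensor_lift (whole sA) W (\<lambda>b w. sweedler sA \<Delta> b (\<lambda>b1 b2.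
       pure (whole sA) (left_free sA W) b1 (pure (whole sA) W b2 w))) x"

definition right_covariant_bimodule where
  "right_covariant_bimodule sA \<Delta> \<epsilon> V l \<longleftrightarrow>
     bialgebra sA \<Delta> \<epsilon> \<and>
     bimodule sA (right_free sA V) l (right_free_mult sA V) \<and>
     (\<forall>a b. \<forall>x\<in>vcarrier (right_free sA V).
        right_coaction sA \<Delta> V (right_free_mult sA V (l a x) b) =
        tensor_product_map (right_free sA V) (whole sA) (whole sA) (whole sA)
          (right_free sA V) (whole sA) (right_free_mult sA V) (*)
          (tensor_product_map (whole sA) (whole sA) (right_free sA V) (whole sA)
             (right_free sA V) (whole sA) l (*) (\<Delta> a) (right_coaction sA \<Delta> V x))
          (\<Delta> b))"

definition left_covariant_bimodule where
  "left_covariant_bimodule sA \<Delta> \<epsilon> W r \<longleftrightarrow>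
     bialgebra sA \<Delta> \<epsilon> \<and>
     bimodule sA (left_free sA W) (left_free_mult sA W) r \<and>
     (\<forall>a b. \<forall>x\<in>vcarrier (left_free sA W).
        left_coaction sA \<Delta> W (r (left_free_mult sA W a x) b) =
        tensor_product_map (whole sA) (left_free sA W) (whole sA) (whole sA)
          (whole sA) (left_free sA W) (*) r
          (tensor_product_map (whole sA) (whole sA) (whole sA) (left_free sA W)
             (whole sA) (left_free sA W) (*) (left_free_mult sA W) (\<Delta> a) (left_coaction sA \<Delta> W x))
          (\<Delta> b))"

end

(* A right A-linear form on V \<otimes> A is determined by its values on the e_i \<otimes> 1, so the pairing identifies
   A \<otimes> V~ with the right dual. On pure tensors, acting on the right by the transposed rule is adjoint to
   acting on the left by the given one, and the bimodule axioms are pulled back along the injective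
   pairing. Over a bialgebra, the coaction b \<otimes> \<alpha> \<mapsto> b_2 \<otimes> b_1 \<otimes> \<alpha> is compatible with left multiplication
   because \<Delta> is multiplicative, and with right multiplication because \<Delta> is also coassociative. *)

theory Submission
  imports Defs
begin

section \<open>Multilinear maps on tensor products\<close>

text \<open>\<open>tensor_lift\<close> is a definite description, so it is under control only for a
  bilinear function and a tensor in the carrier. Identities between nested lifts are therefore
  mostly reduced: each side is shown linear in one argument, and that argument is specialised to a
  pure tensor. This shapes the actions as well. \<open>\<Lambda> a\<close> is in general not pure,
  so the actions are first studied for an arbitrary tensor in its place, where the specialisation is
  possible. The co-opposite is dictated by the order of the legs a1, a2, a3 of a. Coacting on (b
  \<otimes> \<alpha>).a splits the second leg of a: a1 acts on \<alpha>, a2 multiplies b1, and a3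
  multiplies the coacting factor b2. Multiplying the coaction of b \<otimes> \<alpha> by the flipped
  coproduct of a splits the first leg instead, and puts the same three legs in the same places. With
  the unflipped coproduct the coacting factor would receive a2 in the first computation and a1 in
  the second.\<close>

lemma linear_on_mem: "linear_on E F f \<Longrightarrow> x \<in> vcarrier E \<Longrightarrow> f x \<in> vcarrier F"
  by (simp add: linear_on_def)

lemma linear_on_ident: "linear_on E E (\<lambda>x. x)"
  by (simp add: linear_on_def)

lemma linear_on_compose:
  "linear_on F X g \<Longrightarrow> linear_on E F f \<Longrightarrow> linear_on E X (\<lambda>x. g (f x))"
  by (simp add: linear_on_def)

lemma bilinear_onI:
  assumes "\<And>x. x \<in> vcarrier E \<Longrightarrow> linear_on F X (\<lambda>y. f x y)"
    and "\<And>y. y \<in> vcarrier F \<Longrightarrow> linear_on E X (\<lambda>x. f x y)"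
  shows "bilinear_on E F X f"
  using assms by (simp add: bilinear_on_def)

lemma bilinear_on_compose_left:
  "bilinear_on E F X f \<Longrightarrow> linear_on Y E g \<Longrightarrow> w \<in> vcarrier F \<Longrightarrow> linear_on Y X (\<lambda>y. f (g y) w)"
  by (simp add: bilinear_on_def linear_on_def)

lemma bilinear_on_compose_right:
  "bilinear_on E F X f \<Longrightarrow> linear_on Y F g \<Longrightarrow> v \<in> vcarrier E \<Longrightarrow> linear_on Y X (\<lambda>y. f v (g y))"
  by (simp add: bilinear_on_def linear_on_def)

lemma bilinear_on_mem:
  "bilinear_on E F X f \<Longrightarrow> v \<in> vcarrier E \<Longrightarrow> w \<in> vcarrier F \<Longrightarrow> f v w \<in> vcarrier X"
  by (simp add: bilinear_on_def linear_on_def)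

lemmas linear_on_pure_left = bilinear_on_compose_left[OF bilinear_on_pure]
lemmas linear_on_pure_right = bilinear_on_compose_right[OF bilinear_on_pure]

lemma linear_on_zero: "vspace X \<Longrightarrow> linear_on E X (\<lambda>x. 0)"
  using vspace_zero[of X]
  by (simp add: linear_on_def vspace_def module.scale_zero_right module_iff_vector_space[symmetric])

lemma linear_on_plus:
  assumes "vspace X" "linear_on E X f" "linear_on E X g"
  shows "linear_on E X (\<lambda>x. f x + g x)"
proof -
  interpret X: vector_space "vscale X" using assms(1) by (simp add: vspace_def)
  show ?thesis using assms vspace_add[OF assms(1)]
    by (simp add: linear_on_def X.scale_right_distrib algebra_simps)
qed

lemma linear_on_sum_fun:
  assumes "vspace X" "\<And>i. i \<in> I \<Longrightarrow> linear_on E X (f i)"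
  shows "linear_on E X (\<lambda>x. \<Sum>i\<in>I. f i x)"
  using assms(2)
  by (induction I rule: infinite_finite_induct) (auto intro: linear_on_zero linear_on_plus assms(1))

lemma linear_on_cong:
  "vspace E \<Longrightarrow> linear_on E X f \<Longrightarrow> (\<And>x. x \<in> vcarrier E \<Longrightarrow> g x = f x) \<Longrightarrow> linear_on E X g"
  by (simp add: linear_on_def vspace_add vspace_scale)

lemma tensor_lift_mem:
  "vspace E \<Longrightarrow> vspace X \<Longrightarrow> bilinear_on E F X f \<Longrightarrow> t \<in> vcarrier (tensor E F) \<Longrightarrow>
    tensor_lift E F f t \<in> vcarrier X"
  by (rule linear_on_mem[OF tensor_lift_linear])

lemma linear_on_tensor_lift_arg:
  "vspace E \<Longrightarrow> vspace X \<Longrightarrow> bilinear_on E F X f \<Longrightarrow> linear_on Y (tensor E F) g \<Longrightarrow>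
    linear_on Y X (\<lambda>y. tensor_lift E F f (g y))"
  by (rule linear_on_compose[OF tensor_lift_linear])

text \<open>One fixed expansion of \<open>t\<close> into pure tensors serves all parameters
  \<open>y\<close>, so the lift is a finite sum of maps linear in \<open>y\<close>. This is what
  makes an inner lift linear in the variables of an outer one.\<close>

lemma linear_on_tensor_lift_fun:
  assumes E: "vspace E" and X: "vspace X" and Y: "vspace Y"
    and t: "t \<in> vcarrier (tensor E F)"
    and f: "\<And>y. y \<in> vcarrier Y \<Longrightarrow> bilinear_on E F X (\<lambda>a b. f y a b)"
    and lin: "\<And>a b. a \<in> vcarrier E \<Longrightarrow> b \<in> vcarrier F \<Longrightarrow> linear_on Y X (\<lambda>y. f y a b)"
  shows "linear_on Y X (\<lambda>y. tensor_lift E F (\<lambda>a b. f y a b) t)"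
proof -
  obtain n :: nat and v w where vw: "\<And>i. i < n \<Longrightarrow> v i \<in> vcarrier E"
    "\<And>i. i < n \<Longrightarrow> w i \<in> vcarrier F" "t = (\<Sum>i<n. pure E F (v i) (w i))"
    using tensor_representation[OF E t] by blast
  show ?thesis
  proof (rule linear_on_cong[OF Y])
    show "linear_on Y X (\<lambda>y. \<Sum>i<n. f y (v i) (w i))"
      by (rule linear_on_sum_fun[OF X]) (simp add: lin vw)
  qed (simp add: vw(3) tensor_lift_sum[OF X f] vw(1,2))
qed

text \<open>The induction principle for tensors: it compares two linear maps directly, without
  exhibiting the bilinear map that they come from.\<close>

lemma tensor_ext:
  assumes E: "vspace E" and g: "linear_on (tensor E F) X g" and h: "linear_on (tensor E F) X h"
    and eq: "\<And>v w. v \<in> vcarrier E \<Longrightarrow> w \<in> vcarrier F \<Longrightarrow> g (pure E F v w) = h (pure E F v w)"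
    and t: "t \<in> vcarrier (tensor E F)"
  shows "g t = h t"
proof -
  obtain n :: nat and v w where vw: "\<And>i. i < n \<Longrightarrow> v i \<in> vcarrier E"
    "\<And>i. i < n \<Longrightarrow> w i \<in> vcarrier F" "t = (\<Sum>i<n. pure E F (v i) (w i))"
    using tensor_representation[OF E t] by blast
  then show ?thesis
    using linear_on_sum[OF vspace_tensor g, of "{..<n}" "\<lambda>i. pure E F (v i) (w i)"]
      linear_on_sum[OF vspace_tensor h, of "{..<n}" "\<lambda>i. pure E F (v i) (w i)"]
    by (simp add: pure_in_tensor eq)
qed

text \<open>Both sides are linear extensions of the same bilinear map, so uniqueness of the lift
  applies.\<close>

lemma linear_on_tensor_lift:
  assumes E: "vspace E" and X: "vspace X" and Y: "vspace Y" and g: "linear_on X Y g"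
    and f: "bilinear_on E F X f" and t: "t \<in> vcarrier (tensor E F)"
  shows "g (tensor_lift E F f t) = tensor_lift E F (\<lambda>a b. g (f a b)) t"
proof -
  have b: "bilinear_on E F Y (\<lambda>a b. g (f a b))"
    using f g by (simp add: bilinear_on_def linear_on_def)
  show ?thesis
    by (rule tensor_lift_unique[OF E Y linear_on_compose[OF g tensor_lift_linear[OF E X f]] _ b t])
      (simp add: tensor_lift_pure[OF X f])
qed

text \<open>Replaces plain congruence under the binders of a lift, where equality is available only
  for values in the carriers.\<close>

lemma tensor_lift_cong:
  assumes E: "vspace E" and F: "vspace F" and X: "vspace X" and f: "bilinear_on E F X f"
    and t: "t \<in> vcarrier (tensor E F)"
    and eq: "\<And>a b. a \<in> vcarrier E \<Longrightarrow> b \<in> vcarrier F \<Longrightarrow> g a b = f a b"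
  shows "tensor_lift E F g t = tensor_lift E F f t"
proof -
  obtain n :: nat and v w where vw: "\<And>i. i < n \<Longrightarrow> v i \<in> vcarrier E"
    "\<And>i. i < n \<Longrightarrow> w i \<in> vcarrier F" "t = (\<Sum>i<n. pure E F (v i) (w i))"
    using tensor_representation[OF E t] by blast
  have "bilinear_on E F X g"
    by (rule bilinear_on_cong[OF E F f eq])
  from tensor_lift_sum[OF X this, of n v w] tensor_lift_sum[OF X f, of n v w] vw eq
  show ?thesis by simp
qed

section \<open>Nested lifts of maps in four variables, and products of tensors\<close>

definition quadrilinear_on where
  "quadrilinear_on E F G H X f \<longleftrightarrow>
     (\<forall>a\<in>vcarrier E. \<forall>b\<in>vcarrier F. bilinear_on G H X (\<lambda>c d. f a b c d)) \<and>
     (\<forall>c\<in>vcarrier G. \<forall>d\<in>vcarrier H. bilinear_on E F X (\<lambda>a b. f a b c d))"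

lemma quadrilinear_onI:
  assumes "\<And>b c d. b \<in> vcarrier F \<Longrightarrow> c \<in> vcarrier G \<Longrightarrow> d \<in> vcarrier H \<Longrightarrow> linear_on E X (\<lambda>a. f a b c d)"
    and "\<And>a c d. a \<in> vcarrier E \<Longrightarrow> c \<in> vcarrier G \<Longrightarrow> d \<in> vcarrier H \<Longrightarrow> linear_on F X (\<lambda>b. f a b c d)"
    and "\<And>a b d. a \<in> vcarrier E \<Longrightarrow> b \<in> vcarrier F \<Longrightarrow> d \<in> vcarrier H \<Longrightarrow> linear_on G X (\<lambda>c. f a b c d)"
    and "\<And>a b c. a \<in> vcarrier E \<Longrightarrow> b \<in> vcarrier F \<Longrightarrow> c \<in> vcarrier G \<Longrightarrow> linear_on H X (\<lambda>d. f a b c d)"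
  shows "quadrilinear_on E F G H X f"
  using assms by (simp add: quadrilinear_on_def bilinear_on_def)

context
  fixes E :: "('k::field, 'b::ab_group_add) vspace" and F :: "('k, 'c::ab_group_add) vspace"
    and G :: "('k, 'd::ab_group_add) vspace" and H :: "('k, 'e::ab_group_add) vspace"
    and X :: "('k, 'f::ab_group_add) vspace" and f
  assumes E: "vspace E" and F: "vspace F" and G: "vspace G" and X: "vspace X"
    and f: "quadrilinear_on E F G H X f"
begin

lemma double_lift_inner:
  "s \<in> vcarrier (tensor G H) \<Longrightarrow> bilinear_on E F X (\<lambda>a b. tensor_lift G H (\<lambda>c d. f a b c d) s)"
  using f unfolding quadrilinear_on_def
  by (intro bilinear_onI linear_on_tensor_lift_fun G X E F) (auto simp: bilinear_on_def)

text \<open>Linearity in \<open>t\<close> needs only that the inner lift is bilinear in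
  \<open>a\<close> and \<open>b\<close>; linearity in \<open>s\<close> is that of an outer lift
  whose integrand depends linearly on a parameter.\<close>

lemma bilinear_on_double_lift:
  "bilinear_on (tensor E F) (tensor G H) X
     (\<lambda>t s. tensor_lift E F (\<lambda>a b. tensor_lift G H (\<lambda>c d. f a b c d) s) t)"
proof (rule bilinear_onI)
  fix t assume t: "t \<in> vcarrier (tensor E F)"
  show "linear_on (tensor G H) X
     (\<lambda>s. tensor_lift E F (\<lambda>a b. tensor_lift G H (\<lambda>c d. f a b c d) s) t)"
    using f
    by (intro linear_on_tensor_lift_fun E X vspace_tensor t double_lift_inner tensor_lift_linear G)
      (auto simp: quadrilinear_on_def)
qed (intro tensor_lift_linear E X double_lift_inner)

lemma double_lift_pure:
  assumes "a \<in> vcarrier E" "b \<in> vcarrier F" "c \<in> vcarrier G" "d \<in> vcarrier H"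
  shows "tensor_lift E F (\<lambda>a b. tensor_lift G H (\<lambda>c d. f a b c d) (pure G H c d)) (pure E F a b)
    = f a b c d"
proof -
  have "bilinear_on G H X (\<lambda>c d. f a b c d)"
    using f assms by (auto simp: quadrilinear_on_def)
  then have "tensor_lift G H (\<lambda>c d. f a b c d) (pure G H c d) = f a b c d"
    by (simp add: tensor_lift_pure[OF X] assms)
  then show ?thesis
    by (simp add: tensor_lift_pure[OF X double_lift_inner] pure_in_tensor assms)
qed

end

text \<open>Both sides are bilinear in \<open>t\<close> and \<open>s\<close>, and on pure tensors
  both reduce to a single value of \<open>f\<close>.\<close>

lemma double_lift_swap:
  assumes E: "vspace E" and F: "vspace F" and G: "vspace G" and H: "vspace H" and X: "vspace X"
    and f: "quadrilinear_on E F G H X f"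
    and t: "t \<in> vcarrier (tensor E F)" and s: "s \<in> vcarrier (tensor G H)"
  shows "tensor_lift E F (\<lambda>a b. tensor_lift G H (\<lambda>c d. f a b c d) s) t =
    tensor_lift G H (\<lambda>c d. tensor_lift E F (\<lambda>a b. f a b c d) t) s"
proof -
  have f': "quadrilinear_on G H E F X (\<lambda>c d a b. f a b c d)"
    using f by (simp add: quadrilinear_on_def)
  note b = bilinear_on_double_lift[OF E F G X f] and b' = bilinear_on_double_lift[OF G H E X f']
  show ?thesis
  proof (rule tensor_ext[OF E _ _ _ t])
    fix v w assume vw: "v \<in> vcarrier E" "w \<in> vcarrier F"
    show "tensor_lift E F (\<lambda>a b. tensor_lift G H (\<lambda>c d. f a b c d) s) (pure E F v w) =
      tensor_lift G H (\<lambda>c d. tensor_lift E F (\<lambda>a b. f a b c d) (pure E F v w)) s"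
    proof (rule tensor_ext[OF G _ _ _ s])
      fix v' w' assume "v' \<in> vcarrier G" "w' \<in> vcarrier H"
      then show "tensor_lift E F (\<lambda>a b. tensor_lift G H (\<lambda>c d. f a b c d) (pure G H v' w')) (pure E F v w) =
        tensor_lift G H (\<lambda>c d. tensor_lift E F (\<lambda>a b. f a b c d) (pure E F v w)) (pure G H v' w')"
        using vw double_lift_pure[OF E F G X f] double_lift_pure[OF G H E X f'] by simp
    qed (use b b' vw in \<open>auto simp: bilinear_on_def pure_in_tensor\<close>)
  qed (use b b' s in \<open>auto simp: bilinear_on_def\<close>)
qed

lemma quadrilinear_on_pure:
  assumes f: "bilinear_on E G X f" and g: "bilinear_on F H Y g"
  shows "quadrilinear_on E F G H (tensor X Y) (\<lambda>a b c d. pure X Y (f a c) (g b d))"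
  by (intro quadrilinear_onI linear_on_pure_left linear_on_pure_right)
    (use f g in \<open>auto simp: bilinear_on_def linear_on_def\<close>)

lemma bilinear_on_tensor_product_map:
  assumes "vspace E" "vspace F" "vspace G" "bilinear_on E G X f" "bilinear_on F H Y g"
  shows "bilinear_on (tensor E F) (tensor G H) (tensor X Y)
    (tensor_product_map E F G H X Y f g)"
  using bilinear_on_double_lift[OF assms(1-3) vspace_tensor quadrilinear_on_pure[OF assms(4,5)]]
  by (simp add: tensor_product_map_def[abs_def])

lemma tensor_product_map_pure:
  assumes "vspace E" "vspace F" "vspace G" "bilinear_on E G X f" "bilinear_on F H Y g"
    and "a \<in> vcarrier E" "b \<in> vcarrier F" "c \<in> vcarrier G" "d \<in> vcarrier H"
  shows "tensor_product_map E F G H X Y f g (pure E F a b) (pure G H c d) = pure X Y (f a c) (g b d)"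
  using double_lift_pure[OF assms(1-3) vspace_tensor quadrilinear_on_pure[OF assms(4,5)]] assms
  by (simp add: tensor_product_map_def)

section \<open>Right duals, and transport of bimodule structures\<close>

lemma linear_on_right_dual:
  assumes N: "bimodule sA N l r" and Y: "Y \<in> vcarrier (right_dual sA N r)"
  shows "linear_on N (whole sA) Y"
proof -
  interpret bimodule sA N l r by fact
  have "Y (vscale N c x) = sA c (Y x)" if x: "x \<in> vcarrier N" for c x
  proof -
    \<comment> \<open>The right dual asks only for additivity and right A-linearity; homogeneity
      over the field comes from acting by the multiple \<open>sA c 1\<close> of the unit.\<close>
    have "r x (sA c 1) = vscale N c (r x 1)"
      using bilinear_r x by (auto simp: bilinear_on_def linear_on_def whole_def)
    then have "vscale N c x = r x (sA c 1)" using r_one[OF x] by simp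
    then show ?thesis using Y x by (simp add: right_dual_def scale_mult_right)
  qed
  then show ?thesis using Y by (simp add: linear_on_def right_dual_def whole_def)
qed

text \<open>Since the two actions on N commute (\<open>l_r\<close>), precomposing Y with the left
  action of b leaves it right linear. Precomposition is contravariant, so the left action becomes a
  right one.\<close>

lemma bimodule_right_dual:
  fixes sA :: "'k::field \<Rightarrow> 'a::{ring,monoid_mult} \<Rightarrow> 'a" and N :: "('k, 'n::ab_group_add) vspace"
  assumes N: "bimodule sA N l r"
  shows "bimodule sA (right_dual sA N r) right_dual_left_mult (right_dual_right_mult N l)"
proof -
  interpret bimodule sA N l r by fact
  have l: "linear_on N N (l a)" for a using bilinear_l by (simp add: bilinear_on_def whole_def)
  have l': "linear_on (whole sA) N (\<lambda>a. l a x)" if "x \<in> vcarrier N" for x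
    using bilinear_l that by (simp add: bilinear_on_def)
  have r: "linear_on N N (\<lambda>x. r x a)" for a using bilinear_r by (simp add: bilinear_on_def whole_def)
  note l_add = l[unfolded linear_on_def, THEN conjunct2, THEN conjunct1, rule_format]
  note l_mem = linear_on_mem[OF l] and r_mem = linear_on_mem[OF r]
  interpret D: vector_space "\<lambda>c (Y :: 'n \<Rightarrow> 'a) x. sA c (Y x)"
    by unfold_locales (auto simp: fun_eq_iff scale_right_distrib scale_left_distrib)
  show ?thesis
  proof unfold_locales
    have "D.subspace (vcarrier (right_dual sA N r))"
      unfolding D.subspace_def right_dual_def
      by (auto simp: algebra_simps scale_right_distrib scale_mult_left)
    then show "vspace (right_dual sA N r)"
      using D.vector_space_axioms by (simp add: vspace_def right_dual_def)
    show "bilinear_on (whole sA) (right_dual sA N r) (right_dual sA N r) right_dual_left_mult"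
      by (auto simp: bilinear_on_def linear_on_def right_dual_def right_dual_left_mult_def whole_def
          fun_eq_iff algebra_simps scale_mult_left scale_mult_right)
    show "bilinear_on (right_dual sA N r) (whole sA) (right_dual sA N r) (right_dual_right_mult N l)"
    proof (rule bilinear_onI)
      fix Y assume Y: "Y \<in> vcarrier (right_dual sA N r)"
      note Y_lin = linear_on_right_dual[OF N Y]
      have "linear_on (whole sA) (whole sA) (\<lambda>a. Y (l a x))" if "x \<in> vcarrier N" for x
        by (rule linear_on_compose[OF Y_lin l'[OF that]])
      then show "linear_on (whole sA) (right_dual sA N r) (\<lambda>a. right_dual_right_mult N l Y a)"
        using Y by (auto simp: linear_on_def right_dual_def right_dual_right_mult_def whole_def
          fun_eq_iff l_mem r_mem l_add vspace_add[OF vspace_N] l_r[symmetric])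
    next
      fix a
      show "linear_on (right_dual sA N r) (right_dual sA N r) (\<lambda>Y. right_dual_right_mult N l Y a)"
        by (auto simp: linear_on_def right_dual_def right_dual_right_mult_def
          fun_eq_iff l_mem r_mem l_add vspace_add[OF vspace_N] l_r[symmetric])
    qed
  qed (auto simp: right_dual_def right_dual_left_mult_def right_dual_right_mult_def fun_eq_iff
      l_one l_mult l_mem mult.assoc)
qed

text \<open>The image under \<theta> of each axiom for N is the axiom for M, and injectivity
  reflects it. The closure assumptions keep both sides of every equation where \<theta> is
  injective.\<close>

lemma bimodule_pullback:
  assumes M: "bimodule sA M l' r'" and N: "vspace N"
    and \<theta>: "linear_on N M \<theta>" and inj: "inj_on \<theta> (vcarrier N)"
    and l_mem: "\<And>a x. x \<in> vcarrier N \<Longrightarrow> l a x \<in> vcarrier N"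
    and r_mem: "\<And>a x. x \<in> vcarrier N \<Longrightarrow> r x a \<in> vcarrier N"
    and l: "\<And>a x. x \<in> vcarrier N \<Longrightarrow> \<theta> (l a x) = l' a (\<theta> x)"
    and r: "\<And>a x. x \<in> vcarrier N \<Longrightarrow> \<theta> (r x a) = r' (\<theta> x) a"
  shows "bimodule sA N l r"
proof -
  interpret M: bimodule sA M l' r' by fact
  note inj' = inj_onD[OF inj]
  have \<theta>': "x \<in> vcarrier N \<Longrightarrow> \<theta> x \<in> vcarrier M"
    "x \<in> vcarrier N \<Longrightarrow> y \<in> vcarrier N \<Longrightarrow> \<theta> (x + y) = \<theta> x + \<theta> y"
    "x \<in> vcarrier N \<Longrightarrow> \<theta> (vscale N c x) = vscale M c (\<theta> x)" for x y c
    using \<theta> by (auto simp: linear_on_def)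
  note mem = l_mem r_mem vspace_add[OF N] vspace_scale[OF N]
  have bl: "l' (a + b) x = l' a x + l' b x" "l' (sA c a) x = vscale M c (l' a x)"
    "l' a (vscale M c x) = vscale M c (l' a x)"
    "r' x (a + b) = r' x a + r' x b" "r' x (sA c a) = vscale M c (r' x a)"
    "r' (vscale M c x) a = vscale M c (r' x a)"
    if "x \<in> vcarrier M" for a b c x
    using M.bilinear_l M.bilinear_r that by (auto simp: bilinear_on_def linear_on_def whole_def)
  have bl': "l' a (x + y) = l' a x + l' a y" "r' (x + y) a = r' x a + r' y a"
    if "x \<in> vcarrier M" "y \<in> vcarrier M" for a x y
    using M.bilinear_l M.bilinear_r that by (auto simp: bilinear_on_def linear_on_def whole_def)
  show ?thesis
    by unfold_locales
      (auto simp: bilinear_on_def linear_on_def whole_def N mem \<theta>' l r bl bl'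
        M.l_one M.l_mult M.r_one M.r_mult M.l_r intro!: inj')
qed

section \<open>Endomorphisms, dual spaces and transposes\<close>

lemma vspace_dual_space: "vspace E \<Longrightarrow> vspace (dual_space E)"
  unfolding dual_space_def
  by (rule vspace_hom_space) (auto intro!: vspace_whole simp: vector_space_def algebra_simps)

lemma whole_simps [simp]: "vcarrier (whole s) = UNIV" "vscale (whole s) = s"
  by (simp_all add: whole_def)

lemma sum_apply: "(\<Sum>i\<in>I. f i) x = (\<Sum>i\<in>I. f i x)"
  by (induction I rule: infinite_finite_induct) simp_all

lemma linear_on_End_apply: "v \<in> vcarrier E \<Longrightarrow> linear_on (End_space E) E (\<lambda>T. T v)"
  by (auto simp: linear_on_def hom_space_def)

lemma linear_on_End: "T \<in> vcarrier (End_space E) \<Longrightarrow> linear_on E E T"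
  by (simp add: hom_space_def)

lemma linear_on_dual_apply: "v \<in> vcarrier E \<Longrightarrow> linear_on (dual_space E) (whole (*)) (\<lambda>\<alpha>. \<alpha> v)"
  by (auto simp: linear_on_def hom_space_def dual_space_def)

lemma linear_on_dual: "\<alpha> \<in> vcarrier (dual_space E) \<Longrightarrow> linear_on E (whole (*)) \<alpha>"
  by (simp add: hom_space_def dual_space_def)

text \<open>No condition on \<open>x\<close>: the default value 0 outside the carrier also lies in
  the carrier. Equalities of functions can thus be checked pointwise without a case
  distinction.\<close>

lemma End_apply_mem: "vspace E \<Longrightarrow> T \<in> vcarrier (End_space E) \<Longrightarrow> T x \<in> vcarrier E"
  by (cases "x \<in> vcarrier E") (auto simp: linear_on_def hom_space_def vspace_zero)

lemma bilinear_on_End_comp: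
  assumes E: "vspace E"
  shows "bilinear_on (End_space E) (End_space E) (End_space E) (\<circ>)"
proof -
  \<comment> \<open>Outside the carrier \<open>T\<close> gives 0, and \<open>S 0 = 0\<close> by
    linearity, so the normalisation survives composition.\<close>
  have mem: "S \<circ> T \<in> vcarrier (End_space E)"
    if "S \<in> vcarrier (End_space E)" "T \<in> vcarrier (End_space E)" for S T
    using that linear_on_0[OF E linear_on_End[OF that(1)]]
    by (auto simp: hom_space_def linear_on_def)
  have lin: "S (x + y) = S x + S y" "S (vscale E c x) = vscale E c (S x)"
    if "S \<in> vcarrier (End_space E)" "x \<in> vcarrier E" "y \<in> vcarrier E" for S x y c
    using linear_on_End[OF that(1)] that(2,3) by (simp_all add: linear_on_def)
  have sc: "vscale (End_space E) c T = (\<lambda>x. vscale E c (T x))" for c T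
    by (simp add: hom_space_def)
  note T = End_apply_mem[OF E]
  show ?thesis
  proof (intro bilinear_onI)
    fix S assume S: "S \<in> vcarrier (End_space E)"
    show "linear_on (End_space E) (End_space E) (\<lambda>T. S \<circ> T)"
      unfolding linear_on_def
      by (intro conjI ballI allI mem S) (simp_all only: sc fun_eq_iff o_apply plus_fun_apply lin[OF S T T] simp_thms)
    show "linear_on (End_space E) (End_space E) (\<lambda>T. T \<circ> S)"
      unfolding linear_on_def
      by (intro conjI ballI allI mem S) (simp_all add: sc fun_eq_iff)
  qed
qed

lemma bilinear_on_End_comp_flip:
  assumes "vspace E"
  shows "bilinear_on (End_space E) (End_space E) (End_space E) (\<lambda>S T. T \<circ> S)"
  using bilinear_on_End_comp[OF assms] by (simp add: bilinear_on_def)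

lemma End_one_in_End: "vspace E \<Longrightarrow> End_one E \<in> vcarrier (End_space E)"
  by (auto simp: End_one_def hom_space_def linear_on_def vspace_add vspace_scale)

lemma transpose_map_dual:
  assumes "vspace E" "T \<in> vcarrier (End_space E)" "\<alpha> \<in> vcarrier (dual_space E)"
  shows "transpose_map E T \<alpha> \<in> vcarrier (dual_space E)"
  using assms linear_on_0[OF assms(1), of "whole (*)" \<alpha>]
  by (auto simp: transpose_map_def dual_space_def hom_space_def linear_on_def whole_def)

lemma linear_on_transpose_map:
  assumes E: "vspace E"
  shows "linear_on (End_space E) (End_space (dual_space E)) (transpose_map E)"
proof -
  have \<alpha>0: "\<alpha> 0 = 0" if "\<alpha> \<in> vcarrier (dual_space E)" for \<alpha>
    using linear_on_0[OF E linear_on_dual[OF that]] .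
  have \<alpha>: "\<alpha> (x + y) = \<alpha> x + \<alpha> y"
    if "\<alpha> \<in> vcarrier (dual_space E)" "x \<in> vcarrier E" "y \<in> vcarrier E" for \<alpha> x y
    using linear_on_dual[OF that(1)] that by (auto simp: linear_on_def)
  have \<alpha>c: "\<alpha> (vscale E c x) = c * \<alpha> x"
    if "\<alpha> \<in> vcarrier (dual_space E)" "x \<in> vcarrier E" for \<alpha> x c
    using linear_on_dual[OF that(1)] that by (auto simp: linear_on_def)
  have T: "T x \<in> vcarrier E" if "T \<in> vcarrier (End_space E)" for T x
    using that vspace_zero[OF E] by (cases "x \<in> vcarrier E") (auto simp: linear_on_def hom_space_def)
  have dsc: "vscale (dual_space E) c \<alpha> = (\<lambda>x. c * \<alpha> x)" for c \<alpha>
    by (simp add: dual_space_def hom_space_def)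
  have esc: "vscale (End_space X) c T = (\<lambda>x. vscale X c (T x))"
    for X :: "('a, 'x::ab_group_add) vspace" and c T
    by (simp add: hom_space_def)
  note d = vspace_add[OF vspace_dual_space[OF E]] vspace_scale[OF vspace_dual_space[OF E]]
  have mem: "transpose_map E T \<in> vcarrier (End_space (dual_space E))"
    if "T \<in> vcarrier (End_space E)" for T
  proof -
    have "linear_on (dual_space E) (dual_space E) (transpose_map E T)"
      using transpose_map_dual[OF E that] d by (simp add: linear_on_def)
        (auto simp: transpose_map_def dsc fun_eq_iff)
    then show ?thesis by (auto simp: hom_space_def transpose_map_def)
  qed
  show ?thesis
    unfolding linear_on_def
  proof (intro conjI ballI allI mem)
    fix S T assume S: "S \<in> vcarrier (End_space E)" and T': "T \<in> vcarrier (End_space E)"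
    show "transpose_map E (S + T) = transpose_map E S + transpose_map E T"
      by (auto simp: transpose_map_def fun_eq_iff \<alpha>[OF _ T[OF S] T[OF T']])
  next
    fix c T assume T': "T \<in> vcarrier (End_space E)"
    show "transpose_map E (vscale (End_space E) c T) =
        vscale (End_space (dual_space E)) c (transpose_map E T)"
      by (auto simp: transpose_map_def esc dsc fun_eq_iff \<alpha>c[OF _ T[OF T']])
  qed
qed

text \<open>This reversal is the source of the flipped composition in
  \<open>right_commutation_rule\<close>. The functional \<alpha> \<circ> S must lie in the dual for
  the second transpose to act on it, whence the assumption on \<open>S\<close>; for \<alpha> outside
  the dual both sides are 0.\<close>

lemma transpose_map_comp:
  assumes E: "vspace E" and S: "S \<in> vcarrier (End_space E)"
  shows "transpose_map E (S \<circ> T) = transpose_map E T \<circ> transpose_map E S"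
proof
  fix \<alpha>
  show "transpose_map E (S \<circ> T) \<alpha> = (transpose_map E T \<circ> transpose_map E S) \<alpha>"
    using transpose_map_dual[OF E S]
      vspace_zero[OF vspace_dual_space[OF E]]
    by (cases "\<alpha> \<in> vcarrier (dual_space E)") (auto simp: transpose_map_def fun_eq_iff)
qed

lemma transpose_map_one: "vspace E \<Longrightarrow> transpose_map E (End_one E) = End_one (dual_space E)"
  using linear_on_0[of E]
  by (auto simp: transpose_map_def End_one_def fun_eq_iff dual_space_def hom_space_def)


section \<open>The bimodule of a commutation rule and its dual\<close>

context k_algebra
begin

lemma vspace_algebra [simp]: "vspace (whole sA)"
  by (rule vspace_whole) (rule vector_space_axioms)

lemma linear_on_mult_left: "linear_on Y (whole sA) g \<Longrightarrow> linear_on Y (whole sA) (\<lambda>y. g y * c)"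
  by (simp add: linear_on_def distrib_right scale_mult_left)

lemma linear_on_mult_right: "linear_on Y (whole sA) g \<Longrightarrow> linear_on Y (whole sA) (\<lambda>y. c * g y)"
  by (simp add: linear_on_def distrib_left scale_mult_right)

lemma bilinear_on_mult: "bilinear_on (whole sA) (whole sA) (whole sA) (*)"
  by (intro bilinear_onI linear_on_mult_left linear_on_mult_right linear_on_ident)

lemma linear_on_scale_left: "linear_on Y (whole (*)) g \<Longrightarrow> linear_on Y (whole sA) (\<lambda>y. sA (g y) c)"
  by (simp add: linear_on_def scale_left_distrib)

lemma linear_on_scale_right: "linear_on Y (whole sA) g \<Longrightarrow> linear_on Y (whole sA) (\<lambda>y. sA k (g y))"
  by (simp add: linear_on_def scale_right_distrib mult.commute)

end

section \<open>Dual bases, and module actions by arbitrary tensors\<close>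

locale dual_bases_over_algebra =
  V: finite_dimensional_vector_space sV B + A: k_algebra sA
  for sV :: "'k::field \<Rightarrow> 'v::ab_group_add \<Rightarrow> 'v" and B
    and sA :: "'k \<Rightarrow> 'a::{ring,monoid_mult} \<Rightarrow> 'a"
begin

abbreviation "kA \<equiv> whole sA"
abbreviation "kV \<equiv> whole sV"
abbreviation "EndV \<equiv> End_space kV"
abbreviation "dV \<equiv> dual_space kV"
abbreviation "EnddV \<equiv> End_space dV"
abbreviation "e \<equiv> dual_basis sV B"

lemma vspaces [simp]:
  "vspace kA" "vspace kV" "vspace EndV" "vspace dV" "vspace EnddV" "vspace (tensor X Y)"
  "vspace (whole ((*) :: 'k \<Rightarrow> 'k \<Rightarrow> 'k))"
  by (auto intro!: vspace_whole vspace_dual_space vspace_hom_space vspace_tensor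
    simp: V.vector_space_axioms A.vector_space_axioms vector_space_def algebra_simps)

lemmas transpose_linear = linear_on_compose[OF linear_on_transpose_map]

lemma transpose_mem [simp]:
  "T \<in> vcarrier EndV \<Longrightarrow> transpose_map kV T \<in> vcarrier EnddV"
  "T \<in> vcarrier EndV \<Longrightarrow> \<alpha> \<in> vcarrier dV \<Longrightarrow> transpose_map kV T \<alpha> \<in> vcarrier dV"
  by (auto intro: linear_on_mem[OF linear_on_transpose_map] transpose_map_dual)

lemma End_mem [simp]:
  "T' \<in> vcarrier EnddV \<Longrightarrow> \<alpha> \<in> vcarrier dV \<Longrightarrow> T' \<alpha> \<in> vcarrier dV"
  "S \<in> vcarrier EndV \<Longrightarrow> T \<in> vcarrier EndV \<Longrightarrow> S \<circ> T \<in> vcarrier EndV"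
  "S' \<in> vcarrier EnddV \<Longrightarrow> T' \<in> vcarrier EnddV \<Longrightarrow> S' \<circ> T' \<in> vcarrier EnddV"
  using bilinear_on_mem[OF bilinear_on_End_comp, of kV S T]
    bilinear_on_mem[OF bilinear_on_End_comp, of dV S' T'] linear_on_mem[OF linear_on_End, of T' dV]
  by simp_all

lemmas pure_mem [simp] = pure_in_tensor

lemmas End_one_mem [simp] = End_one_in_End[of kV, simplified] End_one_in_End[of dV, simplified]

lemma basis_in_dual [simp]: "e i \<in> vcarrier dV"
  by (auto simp: dual_space_def hom_space_def linear_on_def dual_basis_def
      V.representation_add V.representation_scale V.independent_Basis V.span_Basis)

lemma basis_expansion: "(\<Sum>i\<in>B. sV (e i v) i) = v"
  using V.sum_representation_eq[OF V.independent_Basis _ V.finite_Basis subset_refl]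
  by (simp add: dual_basis_def V.span_Basis)

lemma dual_basis_expansion:
  assumes "\<alpha> \<in> vcarrier dV"
  shows "(\<Sum>i\<in>B. vscale dV (\<alpha> i) (e i)) = \<alpha>"
proof
  fix v
  have "\<alpha> v = \<alpha> (\<Sum>i\<in>B. sV (e i v) i)" by (simp add: basis_expansion)
  also have "\<dots> = (\<Sum>i\<in>B. \<alpha> (sV (e i v) i))"
    by (rule linear_on_sum[OF _ linear_on_dual[OF assms]]) simp_all
  also have "\<dots> = (\<Sum>i\<in>B. \<alpha> i * e i v)"
    using linear_on_dual[OF assms] by (simp add: linear_on_def mult.commute)
  finally show "(\<Sum>i\<in>B. vscale dV (\<alpha> i) (e i)) v = \<alpha> v"
    by (simp add: dual_space_def hom_space_def sum_apply)
qed

text \<open>Backward rules that peel one operation at a time off the variable of a linearity goal,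
  leaving carrier conditions to \<open>simp\<close>. \<open>act_lin\<close> and
  \<open>sw_lin\<close> extend the scheme to the module actions and to Sweedler sums.\<close>

lemmas lin = linear_on_ident linear_on_pure_left linear_on_pure_right
  A.linear_on_mult_left A.linear_on_mult_right A.linear_on_scale_left A.linear_on_scale_right
  linear_on_End_apply linear_on_dual_apply transpose_linear
  linear_on_End[of _ kV] linear_on_End[of _ dV] linear_on_dual[of _ kV]

text \<open>The actions of a commutation rule with its value at a replaced by an arbitrary tensor
  \<open>t\<close>, so that identities can be tested on t = c \<otimes> T.\<close>

definition lact where
  "lact t x = tensor_lift kA EndV
     (\<lambda>c T. tensor_lift kV kA (\<lambda>v b. pure kV kA (T v) (c * b)) x) t"

definition ract where
  "ract x t = tensor_lift kA dV
     (\<lambda>b w. tensor_lift kA EnddV (\<lambda>c T. pure kA dV (b * c) (T w)) t) x"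

text \<open>\<open>dual_pairing\<close> without the cut-off outside the carrier: a plain double
  lift, to which \<open>bilinear_on_double_lift\<close> applies.\<close>

definition pairing where
  "pairing x y = tensor_lift kA dV
     (\<lambda>a \<alpha>. tensor_lift kV kA (\<lambda>v b. sA (\<alpha> v) (a * b)) y) x"

definition transpose_tensor where
  "transpose_tensor t = tensor_lift kA EndV (\<lambda>c T. pure kA EnddV c (transpose_map kV T)) t"

lemma quadrilinear_lact:
  "quadrilinear_on kA EndV kV kA (tensor kV kA) (\<lambda>c T v b. pure kV kA (T v) (c * b))"
  by (rule quadrilinear_onI; (rule lin | simp)+)

lemma quadrilinear_ract:
  "quadrilinear_on kA dV kA EnddV (tensor kA dV) (\<lambda>b w c T. pure kA dV (b * c) (T w))"
  by (rule quadrilinear_onI; (rule lin | simp)+)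

lemma quadrilinear_pairing:
  "quadrilinear_on kA dV kV kA kA (\<lambda>a \<alpha> v b. sA (\<alpha> v) (a * b))"
  by (rule quadrilinear_onI; (rule lin | simp)+)

text \<open>The index lists pick the vector spaces in the order E, F, G, X of the double lift; here
  these are A, End V, V and the target tensor product.\<close>

lemmas bilinear_lact = bilinear_on_double_lift[OF vspaces(1,3,2,6) quadrilinear_lact, folded lact_def]
lemmas bilinear_ract = bilinear_on_double_lift[OF vspaces(1,4,1,6) quadrilinear_ract, folded ract_def]
lemmas bilinear_pairing =
  bilinear_on_double_lift[OF vspaces(1,4,2,1) quadrilinear_pairing, folded pairing_def]

lemma bilinear_transpose: "bilinear_on kA EndV (tensor kA EnddV) (\<lambda>c T. pure kA EnddV c (transpose_map kV T))"
  by (rule bilinear_onI; (rule lin | simp)+)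

lemma linear_transpose_tensor: "linear_on (tensor kA EndV) (tensor kA EnddV) transpose_tensor"
  using tensor_lift_linear[OF _ _ bilinear_transpose] by (simp add: transpose_tensor_def[abs_def])

lemma lact_pure [simp]:
  "T \<in> vcarrier EndV \<Longrightarrow> lact (pure kA EndV c T) (pure kV kA v b) = pure kV kA (T v) (c * b)"
  using double_lift_pure[OF vspaces(1,3,2,6) quadrilinear_lact] by (simp add: lact_def)

lemma ract_pure [simp]:
  "w \<in> vcarrier dV \<Longrightarrow> T \<in> vcarrier EnddV \<Longrightarrow>
    ract (pure kA dV b w) (pure kA EnddV c T) = pure kA dV (b * c) (T w)"
  using double_lift_pure[OF vspaces(1,4,1,6) quadrilinear_ract] by (simp add: ract_def)

lemma pairing_pure [simp]:
  "\<alpha> \<in> vcarrier dV \<Longrightarrow> pairing (pure kA dV a \<alpha>) (pure kV kA v b) = sA (\<alpha> v) (a * b)"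
  using double_lift_pure[OF vspaces(1,4,2,1) quadrilinear_pairing] by (simp add: pairing_def)

lemma transpose_tensor_pure [simp]:
  "T \<in> vcarrier EndV \<Longrightarrow>
    transpose_tensor (pure kA EndV c T) = pure kA EnddV c (transpose_map kV T)"
  by (simp add: transpose_tensor_def tensor_lift_pure[OF _ bilinear_transpose])

abbreviation "mul_comp \<equiv> tensor_product_map kA EndV kA EndV kA EndV (*) (\<circ>)"
abbreviation "mul_comp' \<equiv> tensor_product_map kA EnddV kA EnddV kA EnddV (*) (\<lambda>S T. T \<circ> S)"
abbreviation "rmul \<equiv> right_free_mult sA kV"
abbreviation "lmul \<equiv> left_free_mult sA dV"

lemmas bilinear_mul_comp = bilinear_on_tensor_product_map[OF vspaces(1,3,1) A.bilinear_on_mult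
  bilinear_on_End_comp[OF vspaces(2)]]
lemmas bilinear_mul_comp' = bilinear_on_tensor_product_map[OF vspaces(1,5,1) A.bilinear_on_mult
  bilinear_on_End_comp_flip[OF vspaces(4)]]

lemma mul_comp_pure [simp]:
  "S \<in> vcarrier EndV \<Longrightarrow> T \<in> vcarrier EndV \<Longrightarrow>
    mul_comp (pure kA EndV a S) (pure kA EndV b T) = pure kA EndV (a * b) (S \<circ> T)"
  using tensor_product_map_pure[OF vspaces(1,3,1) A.bilinear_on_mult bilinear_on_End_comp[OF vspaces(2)]]
  by simp

lemma mul_comp'_pure [simp]:
  "S \<in> vcarrier EnddV \<Longrightarrow> T \<in> vcarrier EnddV \<Longrightarrow>
    mul_comp' (pure kA EnddV a S) (pure kA EnddV b T) = pure kA EnddV (a * b) (T \<circ> S)"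
  using tensor_product_map_pure[OF vspaces(1,5,1) A.bilinear_on_mult bilinear_on_End_comp_flip[OF vspaces(4)]]
  by simp

lemma bilinear_rmul: "bilinear_on (tensor kV kA) kA (tensor kV kA) rmul"
  unfolding right_free_mult_def
  by (rule bilinear_onI; (rule lin bilinear_onI linear_on_tensor_lift_fun linear_on_tensor_lift_arg | simp)+)

lemma bilinear_lmul: "bilinear_on kA (tensor kA dV) (tensor kA dV) lmul"
  unfolding left_free_mult_def
  by (rule bilinear_onI; (rule lin bilinear_onI linear_on_tensor_lift_fun linear_on_tensor_lift_arg | simp)+)

lemma rmul_pure [simp]: "rmul (pure kV kA v c) b = pure kV kA v (c * b)"
  unfolding right_free_mult_def
  by (rule tensor_lift_pure[of "tensor kV kA"]; (rule lin bilinear_onI | simp)+)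

lemma lmul_pure [simp]:
  "\<alpha> \<in> vcarrier dV \<Longrightarrow> lmul a (pure kA dV c \<alpha>) = pure kA dV (a * c) \<alpha>"
  unfolding left_free_mult_def
  by (rule tensor_lift_pure[of "tensor kA dV"]; (rule lin bilinear_onI | simp)+)

lemmas act_lin =
  bilinear_on_compose_left[OF bilinear_lact] bilinear_on_compose_right[OF bilinear_lact]
  bilinear_on_compose_left[OF bilinear_ract] bilinear_on_compose_right[OF bilinear_ract]
  bilinear_on_compose_left[OF bilinear_pairing] bilinear_on_compose_right[OF bilinear_pairing]
  bilinear_on_compose_left[OF bilinear_mul_comp] bilinear_on_compose_right[OF bilinear_mul_comp]
  bilinear_on_compose_left[OF bilinear_mul_comp'] bilinear_on_compose_right[OF bilinear_mul_comp']
  bilinear_on_compose_left[OF bilinear_rmul] bilinear_on_compose_right[OF bilinear_rmul]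
  bilinear_on_compose_left[OF bilinear_lmul] bilinear_on_compose_right[OF bilinear_lmul]
  linear_on_compose[OF linear_transpose_tensor]

lemmas act_mem [simp] = bilinear_on_mem[OF bilinear_lact] bilinear_on_mem[OF bilinear_ract]
  bilinear_on_mem[OF bilinear_mul_comp] bilinear_on_mem[OF bilinear_mul_comp']
  bilinear_on_mem[OF bilinear_rmul, simplified] bilinear_on_mem[OF bilinear_lmul, simplified]
  linear_on_mem[OF linear_transpose_tensor]

text \<open>On pure tensors both sides are S (T v) \<otimes> c d b, up to associativity in
  A.\<close>

lemma lact_mult:
  assumes s: "s \<in> vcarrier (tensor kA EndV)" and t: "t \<in> vcarrier (tensor kA EndV)"
    and x: "x \<in> vcarrier (tensor kV kA)"
  shows "lact (mul_comp s t) x = lact s (lact t x)"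
\<comment> \<open>The maps are named explicitly because unification of \<open>g s\<close> leaves
  open which occurrences of \<open>s\<close> are meant to vary.\<close>
proof (rule tensor_ext[where g = "\<lambda>s. lact (mul_comp s t) x" and h = "\<lambda>s. lact s (lact t x)", OF _ _ _ _ s])
  fix c S assume S: "S \<in> vcarrier EndV"
  let ?s = "pure kA EndV c S"
  show "lact (mul_comp ?s t) x = lact ?s (lact t x)"
  proof (rule tensor_ext[where g = "\<lambda>t. lact (mul_comp ?s t) x" and h = "\<lambda>t. lact ?s (lact t x)", OF _ _ _ _ t])
    fix d T assume T: "T \<in> vcarrier EndV"
    let ?t = "pure kA EndV d T"
    show "lact (mul_comp ?s ?t) x = lact ?s (lact ?t x)"
      by (rule tensor_ext[where g = "\<lambda>x. lact (mul_comp ?s ?t) x" and h = "\<lambda>x. lact ?s (lact ?t x)", OF _ _ _ _ x];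
          (rule lin act_lin | simp add: S T mult.assoc)+)
  qed ((rule lin act_lin | simp add: S x)+)
qed ((rule lin act_lin | simp add: t x)+)

lemma transpose_apply [simp]: "\<alpha> \<in> vcarrier dV \<Longrightarrow> transpose_map kV T \<alpha> v = \<alpha> (T v)"
  by (simp add: transpose_map_def)

text \<open>Transposition keeps the order in A and reverses it in End V; the flipped composition in
  \<open>mul_comp'\<close> absorbs the reversal.\<close>

lemma transpose_tensor_mult:
  assumes s: "s \<in> vcarrier (tensor kA EndV)" and t: "t \<in> vcarrier (tensor kA EndV)"
  shows "transpose_tensor (mul_comp s t) = mul_comp' (transpose_tensor s) (transpose_tensor t)"
proof (rule tensor_ext[where g = "\<lambda>s. transpose_tensor (mul_comp s t)"
      and h = "\<lambda>s. mul_comp' (transpose_tensor s) (transpose_tensor t)", OF _ _ _ _ s])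
  fix c S assume S: "S \<in> vcarrier EndV"
  let ?s = "pure kA EndV c S"
  show "transpose_tensor (mul_comp ?s t) = mul_comp' (transpose_tensor ?s) (transpose_tensor t)"
    by (rule tensor_ext[where g = "\<lambda>t. transpose_tensor (mul_comp ?s t)"
        and h = "\<lambda>t. mul_comp' (transpose_tensor ?s) (transpose_tensor t)", OF _ _ _ _ t];
        (rule lin act_lin | simp add: S transpose_map_comp)+)
qed ((rule lin act_lin | simp add: t)+)

text \<open>For x = a \<otimes> \<alpha>, t = c \<otimes> T, y = v \<otimes> b both sides are a c b
  scaled by \<alpha> (T v). The transpose moves T across, and c sits between a and b either
  way.\<close>

lemma pairing_ract:
  assumes x: "x \<in> vcarrier (tensor kA dV)" and t: "t \<in> vcarrier (tensor kA EndV)"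
    and y: "y \<in> vcarrier (tensor kV kA)"
  shows "pairing (ract x (transpose_tensor t)) y = pairing x (lact t y)"
proof (rule tensor_ext[where g = "\<lambda>x. pairing (ract x (transpose_tensor t)) y"
      and h = "\<lambda>x. pairing x (lact t y)", OF _ _ _ _ x])
  fix a \<alpha> assume \<alpha>: "\<alpha> \<in> vcarrier dV"
  let ?x = "pure kA dV a \<alpha>"
  show "pairing (ract ?x (transpose_tensor t)) y = pairing ?x (lact t y)"
  proof (rule tensor_ext[where g = "\<lambda>t. pairing (ract ?x (transpose_tensor t)) y"
        and h = "\<lambda>t. pairing ?x (lact t y)", OF _ _ _ _ t])
    fix c T assume T: "T \<in> vcarrier EndV"
    let ?t = "pure kA EndV c T"
    show "pairing (ract ?x (transpose_tensor ?t)) y = pairing ?x (lact ?t y)"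
      by (rule tensor_ext[where g = "\<lambda>y. pairing (ract ?x (transpose_tensor ?t)) y"
          and h = "\<lambda>y. pairing ?x (lact ?t y)", OF _ _ _ _ y];
          (rule lin act_lin | simp add: \<alpha> T mult.assoc)+)
  qed ((rule lin act_lin | simp add: \<alpha> y)+)
qed ((rule lin act_lin | simp add: t y)+)

lemma pairing_lmul:
  assumes x: "x \<in> vcarrier (tensor kA dV)" and y: "y \<in> vcarrier (tensor kV kA)"
  shows "pairing (lmul a x) y = a * pairing x y"
proof (rule tensor_ext[where g = "\<lambda>x. pairing (lmul a x) y" and h = "\<lambda>x. a * pairing x y", OF _ _ _ _ x])
  fix c \<alpha> assume \<alpha>: "\<alpha> \<in> vcarrier dV"
  let ?x = "pure kA dV c \<alpha>"
  show "pairing (lmul a ?x) y = a * pairing ?x y"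
    by (rule tensor_ext[where g = "\<lambda>y. pairing (lmul a ?x) y" and h = "\<lambda>y. a * pairing ?x y", OF _ _ _ _ y];
        (rule lin act_lin | simp add: \<alpha> mult.assoc A.scale_mult_right)+)
qed ((rule lin act_lin | simp add: y)+)

lemma pairing_rmul:
  assumes x: "x \<in> vcarrier (tensor kA dV)" and y: "y \<in> vcarrier (tensor kV kA)"
  shows "pairing x (rmul y b) = pairing x y * b"
proof (rule tensor_ext[where g = "\<lambda>x. pairing x (rmul y b)" and h = "\<lambda>x. pairing x y * b", OF _ _ _ _ x])
  fix c \<alpha> assume \<alpha>: "\<alpha> \<in> vcarrier dV"
  let ?x = "pure kA dV c \<alpha>"
  show "pairing ?x (rmul y b) = pairing ?x y * b"
    by (rule tensor_ext[where g = "\<lambda>y. pairing ?x (rmul y b)" and h = "\<lambda>y. pairing ?x y * b", OF _ _ _ _ y];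
        (rule lin act_lin | simp add: \<alpha> mult.assoc A.scale_mult_left)+)
qed ((rule lin act_lin | simp add: y)+)

lemma End_one_apply [simp]: "End_one kV v = v"
  by (simp add: End_one_def)

lemma lact_one: "x \<in> vcarrier (tensor kV kA) \<Longrightarrow> lact (pure kA EndV 1 (End_one kV)) x = x"
  by (rule tensor_ext[where g = "\<lambda>x. lact (pure kA EndV 1 (End_one kV)) x" and h = "\<lambda>x. x"];
      (rule lin act_lin | simp)+)

lemma rmul_one: "x \<in> vcarrier (tensor kV kA) \<Longrightarrow> rmul x 1 = x"
  by (rule tensor_ext[where g = "\<lambda>x. rmul x 1" and h = "\<lambda>x. x"]; (rule lin act_lin | simp)+)

lemma rmul_mult: "x \<in> vcarrier (tensor kV kA) \<Longrightarrow> rmul x (a * b) = rmul (rmul x a) b"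
  by (rule tensor_ext[where g = "\<lambda>x. rmul x (a * b)" and h = "\<lambda>x. rmul (rmul x a) b"];
      (rule lin act_lin | simp add: mult.assoc)+)

lemma rmul_lact:
  assumes t: "t \<in> vcarrier (tensor kA EndV)" and x: "x \<in> vcarrier (tensor kV kA)"
  shows "rmul (lact t x) b = lact t (rmul x b)"
proof (rule tensor_ext[where g = "\<lambda>t. rmul (lact t x) b" and h = "\<lambda>t. lact t (rmul x b)", OF _ _ _ _ t])
  fix c T assume T: "T \<in> vcarrier EndV"
  let ?t = "pure kA EndV c T"
  show "rmul (lact ?t x) b = lact ?t (rmul x b)"
    by (rule tensor_ext[where g = "\<lambda>x. rmul (lact ?t x) b" and h = "\<lambda>x. lact ?t (rmul x b)", OF _ _ _ _ x];
        (rule lin act_lin | simp add: T mult.assoc)+)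
qed ((rule lin act_lin | simp add: x)+)

section \<open>Inverting the pairing by means of dual bases\<close>

lemma dual_pairing_eq:
  "dual_pairing sA kV x = (\<lambda>y. if y \<in> vcarrier (tensor kV kA) then pairing x y else 0)"
  unfolding dual_pairing_def pairing_def right_free_def ..

text \<open>The candidate inverse of the pairing: record the values of Y on the free generators and
  attach the dual basis.\<close>

definition components_tensor where
  "components_tensor Y = (\<Sum>i\<in>B. pure kA dV (Y (pure kV kA i 1)) (e i))"

lemma pure_scale_right: "\<alpha> \<in> vcarrier dV \<Longrightarrow> pure kA dV a (vscale dV c \<alpha>) = pure kA dV (sA c a) \<alpha>"
  using bilinear_on_pure[of kA dV] by (simp add: bilinear_on_def linear_on_def)

text \<open>The expansion of \<alpha> in the dual basis, with its scalar coefficients moved across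
  the tensor sign. It yields both one half of the inversion and the basis formula for the right
  multiplication.\<close>

lemma pure_dual_expansion:
  assumes \<alpha>: "\<alpha> \<in> vcarrier dV"
  shows "(\<Sum>i\<in>B. pure kA dV (sA (\<alpha> i) a) (e i)) = pure kA dV a \<alpha>"
proof -
  have "pure kA dV a \<alpha> = pure kA dV a (\<Sum>i\<in>B. vscale dV (\<alpha> i) (e i))"
    by (simp add: dual_basis_expansion[OF \<alpha>])
  also have "\<dots> = (\<Sum>i\<in>B. pure kA dV a (vscale dV (\<alpha> i) (e i)))"
    by (rule linear_on_sum[of dV "tensor kA dV"]) ((rule lin | simp add: vspace_scale)+)
  finally show ?thesis by (simp add: pure_scale_right)
qed

lemma pure_basis_expansion: "(\<Sum>i\<in>B. pure kV kA i (sA (e i v) b)) = pure kV kA v b"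
proof -
  have sc: "pure kV kA (sV c w) b = pure kV kA w (sA c b)" for c w
    using bilinear_on_pure[of kV kA] by (simp add: bilinear_on_def linear_on_def)
  have "pure kV kA v b = pure kV kA (\<Sum>i\<in>B. sV (e i v) i) b" by (simp add: basis_expansion)
  also have "\<dots> = (\<Sum>i\<in>B. pure kV kA (sV (e i v) i) b)"
    by (rule linear_on_sum[where f = "\<lambda>v. pure kV kA v b", of kV "tensor kV kA"]) ((rule lin | simp)+)
  finally show ?thesis by (simp add: sc)
qed

text \<open>Pairing a \<otimes> \<alpha> with the generator of index i gives \<alpha>(i) a, so the
  sum is the dual expansion of a \<otimes> \<alpha>.\<close>

lemma components_pairing:
  assumes x: "x \<in> vcarrier (tensor kA dV)"
  shows "(\<Sum>i\<in>B. pure kA dV (pairing x (pure kV kA i 1)) (e i)) = x"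
  by (rule tensor_ext[where g = "\<lambda>x. (\<Sum>i\<in>B. pure kA dV (pairing x (pure kV kA i 1)) (e i))"
        and h = "\<lambda>x. x", OF _ _ _ _ x];
      (rule lin act_lin linear_on_sum_fun | simp add: pure_dual_expansion)+)

lemma pairing_sum:
  assumes "y \<in> vcarrier (tensor kV kA)" "\<And>i. i \<in> I \<Longrightarrow> x i \<in> vcarrier (tensor kA dV)"
  shows "pairing (\<Sum>i\<in>I. x i) y = (\<Sum>i\<in>I. pairing (x i) y)"
  by (rule linear_on_sum[where f = "\<lambda>x. pairing x y", of "tensor kA dV" kA])
    ((rule lin act_lin | simp add: assms)+)

lemma pairing_components:
  assumes Y: "linear_on (tensor kV kA) kA Y" and r: "\<And>x a. x \<in> vcarrier (tensor kV kA) \<Longrightarrow> Y (rmul x a) = Y x * a"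
    and y: "y \<in> vcarrier (tensor kV kA)"
  shows "pairing (components_tensor Y) y = Y y"
proof (rule tensor_ext[where g = "\<lambda>y. pairing (components_tensor Y) y" and h = Y, OF _ _ _ _ y])
  have c: "components_tensor Y \<in> vcarrier (tensor kA dV)"
    unfolding components_tensor_def by (intro vspace_sum) simp_all
  show "linear_on (tensor kV kA) kA (\<lambda>y. pairing (components_tensor Y) y)"
    by (rule lin act_lin | simp add: c)+
  fix v b
  have "pairing (components_tensor Y) (pure kV kA v b) =
      (\<Sum>i\<in>B. Y (pure kV kA i 1) * sA (e i v) b)"
    by (simp add: components_tensor_def pairing_sum A.scale_mult_right)
  \<comment> \<open>Right linearity of \<open>Y\<close>, read backwards, absorbs the algebra factor
    into the argument.\<close>
  also have "\<dots> = (\<Sum>i\<in>B. Y (pure kV kA i (sA (e i v) b)))"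
    by (simp add: r[symmetric])
  also have "\<dots> = Y (\<Sum>i\<in>B. pure kV kA i (sA (e i v) b))"
    by (rule linear_on_sum[OF _ Y, symmetric]) simp_all
  finally show "pairing (components_tensor Y) (pure kV kA v b) = Y (pure kV kA v b)"
    by (simp add: pure_basis_expansion)
qed (simp_all add: Y)

abbreviation "rdual \<equiv> right_dual sA (tensor kV kA) rmul"

lemma dual_pairing_mem:
  "x \<in> vcarrier (tensor kA dV) \<Longrightarrow> dual_pairing sA kV x \<in> vcarrier rdual"
  \<comment> \<open>\<open>act_lin(6)\<close> is linearity of the pairing in its second
    argument.\<close>
  using act_lin(6)[OF linear_on_ident, of x]
  by (auto simp: dual_pairing_eq right_dual_def linear_on_def pairing_rmul vspace_add
      act_mem)

lemma linear_dual_pairing: "linear_on (tensor kA dV) rdual (dual_pairing sA kV)"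
proof -
  have "linear_on (tensor kA dV) kA (\<lambda>x. pairing x y)" if "y \<in> vcarrier (tensor kV kA)" for y
    using that by (rule act_lin(5)[OF linear_on_ident])
  then show ?thesis
    unfolding linear_on_def
    by (intro conjI ballI allI dual_pairing_mem) (auto simp: dual_pairing_eq fun_eq_iff right_dual_def)
qed

end

section \<open>The two bimodules of a commutation rule and the isomorphism with the right
  dual\<close>

locale commutation = dual_bases_over_algebra +
  fixes \<Lambda>
  assumes commutation_rule: "commutation_rule sA kV \<Lambda>"
begin

abbreviation "lmult \<equiv> commutation_left_mult sA kV \<Lambda>"
abbreviation "\<Phi> \<equiv> transpose_rule sA kV \<Lambda>"
abbreviation "rmult \<equiv> commutation_right_mult sA dV \<Phi>"

lemma linear_\<Lambda>: "linear_on kA (tensor kA EndV) \<Lambda>"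
  and \<Lambda>_one: "\<Lambda> 1 = pure kA EndV 1 (End_one kV)"
  and \<Lambda>_mult: "\<Lambda> (a * b) = mul_comp (\<Lambda> a) (\<Lambda> b)"
  using commutation_rule by (simp_all add: commutation_rule_def)

lemma \<Lambda>_mem [simp]: "\<Lambda> a \<in> vcarrier (tensor kA EndV)"
  using linear_on_mem[OF linear_\<Lambda>] by simp

lemmas \<Lambda>_lin = linear_on_compose[OF linear_\<Lambda>]

lemma lmult_eq: "lmult a x = lact (\<Lambda> a) x"
  by (simp add: commutation_left_mult_def lact_def)

lemma \<Phi>_eq: "\<Phi> a = transpose_tensor (\<Lambda> a)"
  by (simp add: transpose_rule_def transpose_tensor_def)

lemma rmult_eq: "rmult x a = ract x (transpose_tensor (\<Lambda> a))"
  by (simp add: commutation_right_mult_def ract_def \<Phi>_eq)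

text \<open>The left-module axioms are the identities for \<open>lact\<close> at tensors
  \<open>\<Lambda> a\<close>, combined with unitality and multiplicativity of \<Lambda>.\<close>

lemma bimodule_right_free: "bimodule sA (tensor kV kA) lmult rmul"
  unfolding lmult_eq[abs_def]
  by unfold_locales
    ((rule bilinear_onI lin act_lin \<Lambda>_lin |
      simp add: \<Lambda>_one \<Lambda>_mult lact_one lact_mult rmul_one rmul_mult rmul_lact)+)

lemma right_commutation_rule_transpose: "right_commutation_rule sA dV \<Phi>"
  unfolding right_commutation_rule_def \<Phi>_eq[abs_def]
  by (intro conjI allI; (rule lin act_lin \<Lambda>_lin |
      simp add: \<Lambda>_one \<Lambda>_mult transpose_tensor_mult transpose_map_one)+)

lemma bij_dual_pairing:
  "bij_betw (dual_pairing sA kV) (vcarrier (tensor kA dV)) (vcarrier rdual)"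
proof (rule bij_betw_byWitness[where f' = components_tensor])
  show "\<forall>x\<in>vcarrier (tensor kA dV). components_tensor (dual_pairing sA kV x) = x"
    by (simp add: components_tensor_def dual_pairing_eq components_pairing)
  show "\<forall>Y\<in>vcarrier rdual. dual_pairing sA kV (components_tensor Y) = Y"
  proof
    fix Y assume Y: "Y \<in> vcarrier rdual"
    \<comment> \<open>Expanding v in the basis needs linearity of \<open>Y\<close> over the field,
      which \<open>linear_on_right_dual\<close> derives from the bimodule structure.\<close>
    from pairing_components[OF linear_on_right_dual[OF bimodule_right_free Y]] Y
    show "dual_pairing sA kV (components_tensor Y) = Y"
      by (auto simp: dual_pairing_eq right_dual_def fun_eq_iff)
  qed
  show "dual_pairing sA kV ` vcarrier (tensor kA dV) \<subseteq> vcarrier rdual"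
    using dual_pairing_mem by blast
  show "components_tensor ` vcarrier rdual \<subseteq> vcarrier (tensor kA dV)"
    by (auto simp: components_tensor_def intro!: vspace_sum)
qed

lemma dual_pairing_lmul:
  "x \<in> vcarrier (tensor kA dV) \<Longrightarrow>
    dual_pairing sA kV (lmul a x) = right_dual_left_mult a (dual_pairing sA kV x)"
  by (auto simp: dual_pairing_eq right_dual_left_mult_def pairing_lmul fun_eq_iff)

lemma dual_pairing_rmult:
  "x \<in> vcarrier (tensor kA dV) \<Longrightarrow>
    dual_pairing sA kV (rmult x a) = right_dual_right_mult (tensor kV kA) lmult (dual_pairing sA kV x) a"
  by (auto simp: dual_pairing_eq right_dual_right_mult_def lmult_eq rmult_eq pairing_ract fun_eq_iff)

lemma dual_pairing_iso:
  "bimodule_iso (tensor kA dV) lmul rmult rdual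
    right_dual_left_mult (right_dual_right_mult (tensor kV kA) lmult) (dual_pairing sA kV)"
  by (simp add: bimodule_iso_def linear_dual_pairing bij_dual_pairing dual_pairing_lmul dual_pairing_rmult)

lemma bimodule_left_free: "bimodule sA (tensor kA dV) lmul rmult"
  by (rule bimodule_pullback[OF bimodule_right_dual[OF bimodule_right_free] _ linear_dual_pairing
        bij_betw_imp_inj_on[OF bij_dual_pairing]])
    \<comment> \<open>\<open>rmult_eq\<close> is kept for a second pass, since it would destroy the
      left side of \<open>dual_pairing_rmult\<close>; it then settles closure under the right
      action.\<close>
    (simp_all add: dual_pairing_lmul dual_pairing_rmult, simp_all add: rmult_eq)

text \<open>Both sides depend linearly on \<open>\<Lambda> a\<close>. For a pure tensor c \<otimes>
  T the right side is the dual expansion of c \<otimes> (e k \<circ> T), because the coefficient of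
  \<open>e m\<close> is the value of e k \<circ> T at m.\<close>

lemma rmult_dual_basis:
  "rmult (pure kA dV 1 (e k)) a = (\<Sum>m\<in>B. pure kA dV (component sV sA B \<Lambda> k m a) (e m))"
proof -
  let ?c = "\<lambda>i t. tensor_lift kA EndV (\<lambda>c T. sA (e k (T i)) c) t"
  have b: "bilinear_on kA EndV kA (\<lambda>c T. sA (e k (T i)) c)" for i
    by (rule bilinear_onI; (rule lin linear_on_compose[OF linear_on_dual[OF basis_in_dual]] | simp)+)
  note c = linear_on_tensor_lift_arg[OF _ _ b]
  have "ract (pure kA dV 1 (e k)) (transpose_tensor t) = (\<Sum>m\<in>B. pure kA dV (?c m t) (e m))"
    if t: "t \<in> vcarrier (tensor kA EndV)" for t
  proof (rule tensor_ext[where g = "\<lambda>t. ract (pure kA dV 1 (e k)) (transpose_tensor t)"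
      and h = "\<lambda>t. (\<Sum>m\<in>B. pure kA dV (?c m t) (e m))", OF _ _ _ _ t])
    fix c T assume T: "T \<in> vcarrier EndV"
    show "ract (pure kA dV 1 (e k)) (transpose_tensor (pure kA EndV c T)) =
      (\<Sum>m\<in>B. pure kA dV (?c m (pure kA EndV c T)) (e m))"
      using pure_dual_expansion[of "transpose_map kV T (e k)" c] T
      by (simp add: tensor_lift_pure[OF _ b])
  qed ((rule lin act_lin linear_on_sum_fun c | simp)+)
  then show ?thesis by (simp add: rmult_eq component_def)
qed

end

section \<open>Sweedler calculus\<close>

text \<open>Linearity in the first argument takes the outer lift out of \<open>P\<close>, and
  linearity in the second does the same for the inner one. The second move happens under the outer
  lift, where \<open>f a b\<close> is known to lie in its carrier only for \<open>a\<close>,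
  \<open>b\<close> in theirs.\<close>

lemma bilinear_on_tensor_lifts:
  assumes E: "vspace E" and F: "vspace F" and G: "vspace G"
    and XYZ: "vspace X" "vspace Y" "vspace Z" and P: "bilinear_on X Y Z P"
    and f: "bilinear_on E F X f" and g: "bilinear_on G H Y g"
    and t: "t \<in> vcarrier (tensor E F)" and s: "s \<in> vcarrier (tensor G H)"
  shows "P (tensor_lift E F f t) (tensor_lift G H g s) =
    tensor_lift E F (\<lambda>a b. tensor_lift G H (\<lambda>c d. P (f a b) (g c d)) s) t"
proof -
  have gs: "tensor_lift G H g s \<in> vcarrier Y"
    by (rule tensor_lift_mem[OF G XYZ(2) g s])
  have b: "bilinear_on E F Z (\<lambda>a b. P (f a b) (tensor_lift G H g s))"
    by (intro bilinear_onI bilinear_on_compose_left[OF P _ gs]) (use f in \<open>simp_all add: bilinear_on_def\<close>)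
  have "P (tensor_lift E F f t) (tensor_lift G H g s) =
      tensor_lift E F (\<lambda>a b. P (f a b) (tensor_lift G H g s)) t"
    by (rule linear_on_tensor_lift[OF E XYZ(1,3) bilinear_on_compose_left[OF P linear_on_ident gs] f t])
  also have "\<dots> = tensor_lift E F (\<lambda>a b. tensor_lift G H (\<lambda>c d. P (f a b) (g c d)) s) t"
  proof (rule tensor_lift_cong[OF E F XYZ(3) b t, symmetric])
    fix a b assume "a \<in> vcarrier E" "b \<in> vcarrier F"
    then have "f a b \<in> vcarrier X" by (rule bilinear_on_mem[OF f])
    from linear_on_tensor_lift[OF G XYZ(2,3) bilinear_on_compose_right[OF P linear_on_ident this] g s]
    show "tensor_lift G H (\<lambda>c d. P (f a b) (g c d)) s = P (f a b) (tensor_lift G H g s)" ..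
  qed
  finally show ?thesis .
qed

section \<open>Sums over the comultiplication, and the co-opposite bialgebra\<close>

context bialgebra
begin

abbreviation "Al \<equiv> whole sA"
abbreviation "\<S> \<equiv> sweedler sA \<Delta>"

lemma comult_mem [simp]: "\<Delta> a \<in> vcarrier (tensor Al Al)"
  using linear_on_mem[OF comult_linear] by simp

lemma linear_on_sweedler_arg:
  "vspace X \<Longrightarrow> bilinear_on Al Al X f \<Longrightarrow> linear_on Y Al g \<Longrightarrow> linear_on Y X (\<lambda>y. \<S> (g y) f)"
  unfolding sweedler_def
  by (intro linear_on_tensor_lift_arg linear_on_compose[OF comult_linear]) simp_all

lemma linear_on_sweedler_fun:
  assumes "vspace X" "vspace Y"
    and "\<And>y. y \<in> vcarrier Y \<Longrightarrow> bilinear_on Al Al X (\<lambda>a b. f y a b)"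
    and "\<And>a b. linear_on Y X (\<lambda>y. f y a b)"
  shows "linear_on Y X (\<lambda>y. \<S> c (\<lambda>a b. f y a b))"
  unfolding sweedler_def using assms by (intro linear_on_tensor_lift_fun) simp_all

lemma linear_sweedler:
  "vspace X \<Longrightarrow> vspace Y \<Longrightarrow> linear_on X Y g \<Longrightarrow> bilinear_on Al Al X f \<Longrightarrow>
    g (\<S> a f) = \<S> a (\<lambda>x y. g (f x y))"
  unfolding sweedler_def by (rule linear_on_tensor_lift[of Al X Y]) simp_all

lemma bilinear_sweedlers:
  assumes "vspace X" "vspace Y" "vspace Z" "bilinear_on X Y Z P"
    "bilinear_on Al Al X f" "bilinear_on Al Al Y g"
  shows "P (\<S> a f) (\<S> b g) = \<S> a (\<lambda>x y. \<S> b (\<lambda>u v. P (f x y) (g u v)))"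
  unfolding sweedler_def by (rule bilinear_on_tensor_lifts[OF _ _ _ assms]) simp_all

lemma sweedler_swap:
  assumes "vspace X" "quadrilinear_on Al Al Al Al X f"
  shows "\<S> a (\<lambda>x y. \<S> b (\<lambda>u v. f x y u v)) = \<S> b (\<lambda>u v. \<S> a (\<lambda>x y. f x y u v))"
  unfolding sweedler_def by (rule double_lift_swap[OF _ _ _ _ assms]) simp_all

text \<open>The axiom \<open>coassoc\<close> is the universal case in which f forms the triple
  tensor. Applying the linear extension \<open>?F\<close> of f to both sides of the axiom gives the
  general case.\<close>

lemma sweedler_coassoc:
  assumes X: "vspace X"
    and f1: "\<And>v w. linear_on Al X (\<lambda>u. f u v w)"
    and f2: "\<And>u w. linear_on Al X (\<lambda>v. f u v w)"
    and f3: "\<And>u v. linear_on Al X (\<lambda>w. f u v w)"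
  shows "\<S> a (\<lambda>x y. \<S> x (\<lambda>u v. f u v y)) = \<S> a (\<lambda>x y. \<S> y (\<lambda>u v. f x u v))"
proof -
  let ?AA = "tensor Al Al"
  let ?F = "tensor_lift Al ?AA (\<lambda>u s. tensor_lift Al Al (\<lambda>v w. f u v w) s)"
  have b: "bilinear_on Al Al X (\<lambda>v w. f u v w)" for u
    by (intro bilinear_onI f2 f3)
  have B: "bilinear_on Al ?AA X (\<lambda>u s. tensor_lift Al Al (\<lambda>v w. f u v w) s)"
    by (intro bilinear_onI linear_on_tensor_lift_fun linear_on_tensor_lift_arg linear_on_ident b
        f1 f2 f3 X vspace_algebra)
  have F: "linear_on (tensor Al ?AA) X ?F"
    by (rule tensor_lift_linear[OF _ X B]) simp
  have F_pure: "?F (pure Al ?AA u (pure Al Al v w)) = f u v w" for u v w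
    by (simp add: tensor_lift_pure[OF X B] tensor_lift_pure[OF X b] pure_in_tensor)
  note p = linear_on_pure_left linear_on_pure_right linear_on_ident bilinear_onI pure_in_tensor
    linear_on_sweedler_arg linear_on_sweedler_fun vspace_tensor vspace_algebra UNIV_I
  \<comment> \<open>Used twice on each side: \<open>?F\<close> passes through the outer sum and then
    through the inner one.\<close>
  note push = linear_sweedler[of "tensor Al ?AA" X ?F, OF vspace_tensor X F]
  have "?F (\<S> a (\<lambda>x y. \<S> x (\<lambda>u v. pure Al ?AA u (pure Al Al v y)))) =
      \<S> a (\<lambda>x y. \<S> x (\<lambda>u v. f u v y))"
    by (subst push, (rule p | simp)+, subst push, (rule p | simp)+, simp only: F_pure)
  moreover have "?F (\<S> a (\<lambda>x y. \<S> y (\<lambda>u v. pure Al ?AA x (pure Al Al u v)))) =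
      \<S> a (\<lambda>x y. \<S> y (\<lambda>u v. f x u v))"
    by (subst push, (rule p | simp)+, subst push, (rule p | simp)+, simp only: F_pure)
  ultimately show ?thesis by (simp only: coassoc)
qed

text \<open>Multiplicativity of \<Delta> presents \<open>\<Delta> (a * b)\<close> as a double sum of
  pure tensors; the lift of \<open>f\<close> is linear and passes through both sums.\<close>

lemma sweedler_mult:
  assumes X: "vspace X" and f: "bilinear_on Al Al X f"
  shows "\<S> (a * b) f = \<S> a (\<lambda>a1 a2. \<S> b (\<lambda>b1 b2. f (a1 * b1) (a2 * b2)))"
proof -
  let ?m = "tensor_product_map Al Al Al Al Al Al (*) (*)"
  note q = quadrilinear_on_pure[OF bilinear_on_mult bilinear_on_mult]
  have b: "bilinear_on Al Al (tensor Al Al) (\<lambda>b1 b2. pure Al Al (a1 * b1) (a2 * b2))" for a1 a2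
    using q by (simp add: quadrilinear_on_def)
  have lin: "linear_on (tensor Al Al) X (tensor_lift Al Al f)"
    by (rule tensor_lift_linear[OF _ X f]) simp
  have "\<S> (a * b) f = tensor_lift Al Al f (\<S> a (\<lambda>a1 a2. \<S> b (\<lambda>b1 b2. pure Al Al (a1 * b1) (a2 * b2))))"
    by (simp add: sweedler_def comult_mult tensor_product_map_def)
  also have "\<dots> = \<S> a (\<lambda>a1 a2. tensor_lift Al Al f (\<S> b (\<lambda>b1 b2. pure Al Al (a1 * b1) (a2 * b2))))"
    unfolding sweedler_def
    by (rule linear_on_tensor_lift[OF _ _ X lin])
       (simp_all add: double_lift_inner[OF _ _ _ _ q] vspace_tensor)
  also have "\<dots> = \<S> a (\<lambda>a1 a2. \<S> b (\<lambda>b1 b2. f (a1 * b1) (a2 * b2)))"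
    by (simp add: linear_sweedler[OF vspace_tensor X lin b] tensor_lift_pure[OF X f])
  finally show ?thesis .
qed

lemma bilinear_swap: "bilinear_on Al Al (tensor Al Al) (\<lambda>x y. pure Al Al y x)"
  using bilinear_on_pure[of Al Al] by (simp add: bilinear_on_def)

text \<open>The bridge by which the coassociativity and counit axioms of the co-opposite reduce to
  those of \<Delta>.\<close>

lemma sweedler_cop:
  assumes X: "vspace X" and f: "bilinear_on Al Al X f"
  shows "sweedler sA (cop sA \<Delta>) a f = \<S> a (\<lambda>x y. f y x)"
proof -
  have "sweedler sA (cop sA \<Delta>) a f = tensor_lift Al Al f (\<S> a (\<lambda>x y. pure Al Al y x))"
    by (simp add: sweedler_def cop_def)
  also have "\<dots> = \<S> a (\<lambda>x y. f y x)"
    by (simp add: linear_sweedler[OF vspace_tensor X tensor_lift_linear[OF _ X f] bilinear_swap]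
        tensor_lift_pure[OF X f])
  finally show ?thesis .
qed

lemma bialgebra_cop: "bialgebra sA (cop sA \<Delta>) \<epsilon>"
proof unfold_locales
  let ?AA = "tensor Al Al"
  note p = linear_on_pure_left linear_on_pure_right linear_on_ident bilinear_onI pure_in_tensor
    linear_on_sweedler_arg linear_on_sweedler_fun vspace_tensor vspace_algebra UNIV_I
    linear_on_scale_left linear_on_scale_right linear_on_compose[OF counit_linear]
  show "linear_on Al ?AA (cop sA \<Delta>)"
    unfolding cop_def[abs_def] by (rule p | simp)+
  fix a
  show "sweedler sA (cop sA \<Delta>) a (\<lambda>x y. sweedler sA (cop sA \<Delta>) x (\<lambda>u v. pure Al ?AA u (pure Al Al v y))) =
     sweedler sA (cop sA \<Delta>) a (\<lambda>x y. sweedler sA (cop sA \<Delta>) y (\<lambda>u v. pure Al ?AA x (pure Al Al u v)))"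
  proof -
    have 1: "sweedler sA (cop sA \<Delta>) x (\<lambda>u v. pure Al ?AA u (pure Al Al v y)) =
      \<S> x (\<lambda>u v. pure Al ?AA v (pure Al Al u y))" for x y
      by (rule sweedler_cop[of "tensor Al ?AA"]; (rule p | simp)+)
    have 2: "sweedler sA (cop sA \<Delta>) y (\<lambda>u v. pure Al ?AA x (pure Al Al u v)) =
      \<S> y (\<lambda>u v. pure Al ?AA x (pure Al Al v u))" for x y
      by (rule sweedler_cop[of "tensor Al ?AA"]; (rule p | simp)+)
    have 3: "sweedler sA (cop sA \<Delta>) a (\<lambda>x y. \<S> x (\<lambda>u v. pure Al ?AA v (pure Al Al u y))) =
      \<S> a (\<lambda>x y. \<S> y (\<lambda>u v. pure Al ?AA v (pure Al Al u x)))"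
      by (rule sweedler_cop[of "tensor Al ?AA"]; (rule p | simp)+)
    have 4: "sweedler sA (cop sA \<Delta>) a (\<lambda>x y. \<S> y (\<lambda>u v. pure Al ?AA x (pure Al Al v u))) =
      \<S> a (\<lambda>x y. \<S> x (\<lambda>u v. pure Al ?AA y (pure Al Al v u)))"
      by (rule sweedler_cop[of "tensor Al ?AA"]; (rule p | simp)+)
    \<comment> \<open>Both sides are now the threefold coproduct of \<open>a\<close> read backwards,
      bracketed in the two possible ways; hence the choice w \<otimes> (v \<otimes> u) for
      f.\<close>
    show ?thesis
      unfolding 1 2 3 4
      by (rule sweedler_coassoc[of "tensor Al ?AA" "\<lambda>u v w. pure Al ?AA w (pure Al Al v u)", symmetric];
          (rule p | simp)+)
  qed
  have "sweedler sA (cop sA \<Delta>) a (\<lambda>x y. sA (\<epsilon> x) y) = \<S> a (\<lambda>x y. sA (\<epsilon> y) x)"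
    by (rule sweedler_cop[of Al]; (rule p | simp)+)
  then show "sweedler sA (cop sA \<Delta>) a (\<lambda>x y. sA (\<epsilon> x) y) = a" by (simp add: counit_right)
  have "sweedler sA (cop sA \<Delta>) a (\<lambda>x y. sA (\<epsilon> y) x) = \<S> a (\<lambda>x y. sA (\<epsilon> x) y)"
    by (rule sweedler_cop[of Al]; (rule p | simp)+)
  then show "sweedler sA (cop sA \<Delta>) a (\<lambda>x y. sA (\<epsilon> y) x) = a" by (simp add: counit_left)
  show "cop sA \<Delta> 1 = pure Al Al 1 1"
    by (simp add: cop_def sweedler_def comult_one tensor_lift_pure[OF vspace_tensor bilinear_swap])
  fix b
  note m = bilinear_on_tensor_product_map[OF vspace_algebra vspace_algebra vspace_algebra
      bilinear_on_mult bilinear_on_mult]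
  have "tensor_product_map Al Al Al Al Al Al (*) (*) (cop sA \<Delta> a) (cop sA \<Delta> b) =
    \<S> a (\<lambda>x y. \<S> b (\<lambda>u v. tensor_product_map Al Al Al Al Al Al (*) (*) (pure Al Al y x) (pure Al Al v u)))"
    unfolding cop_def
    by (rule bilinear_sweedlers[OF vspace_tensor vspace_tensor vspace_tensor m bilinear_swap bilinear_swap])
  also have "\<dots> = cop sA \<Delta> (a * b)"
    by (simp add: cop_def sweedler_mult[OF vspace_tensor bilinear_swap] tensor_product_map_pure bilinear_on_mult)
  finally show "cop sA \<Delta> (a * b) =
    tensor_product_map Al Al Al Al Al Al (*) (*) (cop sA \<Delta> a) (cop sA \<Delta> b)" ..
qed (simp_all add: counit_linear counit_one counit_mult)

end

section \<open>Covariance of the dual bimodule\<close>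

locale representation_commutation =
  commutation sV B sA \<Lambda> + C: bialgebra sA \<Delta> \<epsilon>
  for sV :: "'k::field \<Rightarrow> 'v::ab_group_add \<Rightarrow> 'v" and B
    and sA :: "'k \<Rightarrow> 'a::{ring,monoid_mult} \<Rightarrow> 'a" and \<Lambda> \<Delta> \<epsilon> +
  fixes \<rho>
  assumes representation: "representation sA kV \<rho>"
    and \<Lambda>_sweedler: "\<Lambda> a = sweedler sA \<Delta> a (\<lambda>a1 a2. pure kA EndV a2 (\<rho> a1))"
begin

abbreviation "\<S> \<equiv> sweedler sA \<Delta>"
abbreviation "\<rho>t a \<equiv> transpose_map kV (\<rho> a)"
abbreviation "AdV \<equiv> tensor kA dV"
abbreviation "coact \<equiv> left_coaction sA (cop sA \<Delta>) dV"

lemma linear_\<rho>: "linear_on kA EndV \<rho>"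
  and \<rho>_one: "\<rho> 1 = End_one kV" and \<rho>_mult: "\<rho> (a * b) = \<rho> a \<circ> \<rho> b"
  using representation by (auto simp: representation_def)

lemma \<rho>_mem [simp]: "\<rho> a \<in> vcarrier EndV"
  using linear_on_mem[OF linear_\<rho>] by simp

lemma linear_\<rho>t: "\<alpha> \<in> vcarrier dV \<Longrightarrow> linear_on Y kA g \<Longrightarrow> linear_on Y dV (\<lambda>y. \<rho>t (g y) \<alpha>)"
  by (rule linear_on_compose[OF linear_on_End_apply[of \<alpha> dV]])
    (rule transpose_linear linear_on_compose[OF linear_\<rho>] | simp)+

lemmas sw_lin = linear_on_ident linear_on_pure_left linear_on_pure_right
  A.linear_on_mult_left A.linear_on_mult_right linear_\<rho>t linear_on_compose[OF linear_\<rho>]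
  C.linear_on_sweedler_arg C.linear_on_sweedler_fun bilinear_onI

lemma right_module_transpose: "right_module_structure sA dV (\<lambda>a. \<rho>t a)"
  unfolding right_module_structure_def
  by (simp add: \<rho>_one \<rho>_mult transpose_map_one transpose_map_comp
      linear_on_compose[OF linear_on_transpose_map linear_\<rho>])

text \<open>For fixed b \<otimes> \<alpha> the right action is linear in the tensor acting, so it
  passes through the Sweedler sum that defines \<open>\<Lambda> a\<close>.\<close>

lemma rmult_pure:
  assumes \<alpha>: "\<alpha> \<in> vcarrier dV"
  shows "rmult (pure kA dV b \<alpha>) a = \<S> a (\<lambda>a1 a2. pure kA dV (b * a2) (\<rho>t a1 \<alpha>))"
proof -
  let ?g = "\<lambda>t. ract (pure kA dV b \<alpha>) (transpose_tensor t)"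
  have g: "linear_on (tensor kA EndV) AdV ?g"
    by (rule lin act_lin | simp add: \<alpha>)+
  have b: "bilinear_on kA kA (tensor kA EndV) (\<lambda>a1 a2. pure kA EndV a2 (\<rho> a1))"
    by (rule sw_lin | simp)+
  have "rmult (pure kA dV b \<alpha>) a = ?g (\<S> a (\<lambda>a1 a2. pure kA EndV a2 (\<rho> a1)))"
    by (simp add: rmult_eq \<Lambda>_sweedler)
  also have "\<dots> = \<S> a (\<lambda>a1 a2. ?g (pure kA EndV a2 (\<rho> a1)))"
    by (rule C.linear_sweedler[OF vspace_tensor vspace_tensor g b])
  finally show ?thesis by (simp add: \<alpha>)
qed

text \<open>One term of the co-opposite coaction, indexed by the legs of the unflipped \<Delta>, so
  that the Sweedler rules for \<Delta> apply.\<close>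

abbreviation "flip3 \<alpha> b1 b2 \<equiv> pure kA AdV b2 (pure kA dV b1 \<alpha>)"

lemma bilinear_flip3: "\<alpha> \<in> vcarrier dV \<Longrightarrow> bilinear_on kA kA (tensor kA AdV) (\<lambda>b1 b2. flip3 \<alpha> b1 b2)"
  by (rule sw_lin | simp)+

lemma cop_sweedler_inner:
  "\<alpha> \<in> vcarrier dV \<Longrightarrow> sweedler sA (cop sA \<Delta>) b (\<lambda>b1 b2. pure kA AdV b1 (pure kA dV b2 \<alpha>)) =
    \<S> b (\<lambda>b1 b2. flip3 \<alpha> b1 b2)"
  by (rule C.sweedler_cop[of "tensor kA AdV"]; (rule sw_lin | simp)+)

text \<open>The sums for \<open>cop\<close> are first rewritten as sums for \<Delta>, which is the
  form that the linearity rules \<open>sw_lin\<close> cover.\<close>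

lemma bilinear_coact:
  "bilinear_on kA dV (tensor kA AdV)
    (\<lambda>b \<alpha>. sweedler sA (cop sA \<Delta>) b (\<lambda>b1 b2. pure kA AdV b1 (pure kA dV b2 \<alpha>)))"
  by (rule bilinear_on_cong[where f = "\<lambda>b \<alpha>. \<S> b (\<lambda>b1 b2. flip3 \<alpha> b1 b2)"])
    (simp_all add: cop_sweedler_inner, (rule sw_lin | simp)+)

lemma linear_coact: "linear_on AdV (tensor kA AdV) coact"
  unfolding left_coaction_def[abs_def] left_free_def
  by (rule tensor_lift_linear[OF _ _ bilinear_coact]) simp_all

lemma coact_pure:
  "\<alpha> \<in> vcarrier dV \<Longrightarrow> coact (pure kA dV b \<alpha>) = \<S> b (\<lambda>b1 b2. flip3 \<alpha> b1 b2)"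
  unfolding left_coaction_def left_free_def
  by (simp add: tensor_lift_pure[OF _ bilinear_coact] cop_sweedler_inner)

lemma coact_mem [simp]: "x \<in> vcarrier AdV \<Longrightarrow> coact x \<in> vcarrier (tensor kA AdV)"
  by (rule linear_on_mem[OF linear_coact])

lemma cop_mem [simp]: "cop sA \<Delta> a \<in> vcarrier (tensor kA kA)"
  using linear_on_mem[OF bialgebra.comult_linear[OF C.bialgebra_cop]] by simp

abbreviation "ltensor \<equiv> tensor_product_map kA kA kA AdV kA AdV (*) lmul"
abbreviation "rtensor \<equiv> tensor_product_map kA AdV kA kA kA AdV (*) rmult"

lemma bilinear_rmult: "bilinear_on AdV kA AdV rmult"
  by (rule bimodule.bilinear_r[OF bimodule_left_free])

lemmas bilinear_ltensor =
  bilinear_on_tensor_product_map[OF vspaces(1,1,1) A.bilinear_on_mult bilinear_lmul]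
lemmas bilinear_rtensor =
  bilinear_on_tensor_product_map[OF vspaces(1,6,1) A.bilinear_on_mult bilinear_rmult]

text \<open>On c \<otimes> \<alpha> both sides are the flipped coproduct of a c followed by
  \<alpha>; the functional is a spectator.\<close>

lemma coact_lmul:
  assumes x: "x \<in> vcarrier AdV"
  shows "coact (lmul a x) = ltensor (cop sA \<Delta> a) (coact x)"
proof (rule tensor_ext[where g = "\<lambda>x. coact (lmul a x)" and h = "\<lambda>x. ltensor (cop sA \<Delta> a) (coact x)",
      OF _ _ _ _ x])
  show "linear_on AdV (tensor kA AdV) (\<lambda>x. coact (lmul a x))"
    by (rule linear_on_compose[OF linear_coact] act_lin linear_on_ident | simp)+
  show "linear_on AdV (tensor kA AdV) (\<lambda>x. ltensor (cop sA \<Delta> a) (coact x))"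
    by (rule bilinear_on_compose_right[OF bilinear_ltensor linear_coact]) simp
  fix c \<alpha> assume \<alpha>: "\<alpha> \<in> vcarrier dV"
  have "ltensor (cop sA \<Delta> a) (coact (pure kA dV c \<alpha>)) =
      ltensor (\<S> a (\<lambda>x y. pure kA kA y x)) (\<S> c (\<lambda>b1 b2. flip3 \<alpha> b1 b2))"
    by (simp add: coact_pure \<alpha> cop_def)
  also have "\<dots> = \<S> a (\<lambda>x y. \<S> c (\<lambda>b1 b2. ltensor (pure kA kA y x) (flip3 \<alpha> b1 b2)))"
    by (rule C.bilinear_sweedlers[OF vspace_tensor vspace_tensor vspace_tensor bilinear_ltensor
        C.bilinear_swap bilinear_flip3[OF \<alpha>]])
  also have "\<dots> = \<S> a (\<lambda>x y. \<S> c (\<lambda>b1 b2. flip3 \<alpha> (x * b1) (y * b2)))"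
    by (simp add: \<alpha> tensor_product_map_pure[OF vspaces(1,1,1) A.bilinear_on_mult bilinear_lmul])
  also have "\<dots> = \<S> (a * c) (\<lambda>b1 b2. flip3 \<alpha> b1 b2)"
    by (rule C.sweedler_mult[OF vspace_tensor bilinear_flip3[OF \<alpha>], symmetric])
  finally show "coact (lmul a (pure kA dV c \<alpha>)) = ltensor (cop sA \<Delta> a) (coact (pure kA dV c \<alpha>))"
    by (simp add: \<alpha> coact_pure)
qed simp

lemma coact_rmult:
  assumes x: "x \<in> vcarrier AdV"
  shows "coact (rmult x b) = rtensor (coact x) (cop sA \<Delta> b)"
proof (rule tensor_ext[where g = "\<lambda>x. coact (rmult x b)" and h = "\<lambda>x. rtensor (coact x) (cop sA \<Delta> b)",
      OF _ _ _ _ x])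
  show "linear_on AdV (tensor kA AdV) (\<lambda>x. coact (rmult x b))"
    by (rule linear_on_compose[OF linear_coact bilinear_on_compose_left[OF bilinear_rmult linear_on_ident]])
      simp
  show "linear_on AdV (tensor kA AdV) (\<lambda>x. rtensor (coact x) (cop sA \<Delta> b))"
    by (rule bilinear_on_compose_left[OF bilinear_rtensor linear_coact]) simp
  fix g \<alpha> assume \<alpha>: "\<alpha> \<in> vcarrier dV"
  have r\<alpha>: "\<rho>t a \<alpha> \<in> vcarrier dV" for a by (simp add: \<alpha>)
  \<comment> \<open>The common form of both sides, with x, u, v the three legs of b: x acts on the
    functional, u multiplies the first leg of g and v the second.\<close>
  let ?f = "\<lambda>g1 g2 x u v. pure kA AdV (g2 * v) (pure kA dV (g1 * u) (\<rho>t x \<alpha>))"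
  have "coact (rmult (pure kA dV g \<alpha>) b) = coact (\<S> b (\<lambda>x y. pure kA dV (g * y) (\<rho>t x \<alpha>)))"
    by (simp add: rmult_pure \<alpha>)
  also have "\<dots> = \<S> b (\<lambda>x y. coact (pure kA dV (g * y) (\<rho>t x \<alpha>)))"
    by (rule C.linear_sweedler[OF _ _ linear_coact]; (rule sw_lin | simp add: \<alpha>)+)
  also have "\<dots> = \<S> b (\<lambda>x y. \<S> g (\<lambda>g1 g2. \<S> y (\<lambda>u v. ?f g1 g2 x u v)))"
    by (simp only: coact_pure[OF r\<alpha>] C.sweedler_mult[OF vspace_tensor bilinear_flip3[OF r\<alpha>]])
  \<comment> \<open>The sum over g moves outside because \<open>bilinear_sweedlers\<close> expands
    \<open>rtensor\<close> with the sum of the coaction outermost.\<close>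
  also have "\<dots> = \<S> g (\<lambda>g1 g2. \<S> b (\<lambda>x y. \<S> y (\<lambda>u v. ?f g1 g2 x u v)))"
    by (rule C.sweedler_swap[of "tensor kA AdV"], simp, rule quadrilinear_onI;
        (rule sw_lin | simp add: \<alpha>)+)
  \<comment> \<open>Coassociativity: instead of the second leg of b, the first one is split. The
    slots of \<open>?f\<close> are filled in the same order as before.\<close>
  also have "\<dots> = \<S> g (\<lambda>g1 g2. \<S> b (\<lambda>x y. \<S> x (\<lambda>u v. ?f g1 g2 u v y)))"
  proof -
    have "\<S> b (\<lambda>x y. \<S> x (\<lambda>u v. ?f g1 g2 u v y)) = \<S> b (\<lambda>x y. \<S> y (\<lambda>u v. ?f g1 g2 x u v))" for g1 g2
      by (rule C.sweedler_coassoc[of "tensor kA AdV"]; (rule sw_lin | simp add: \<alpha>)+)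
    then show ?thesis by simp
  qed
  \<comment> \<open>Read from the right: \<open>rtensor\<close> multiplies g2 by y and lets x act on
    the remaining factor, and by \<open>rmult_pure\<close> this action is what splits x.\<close>
  also have "\<dots> = \<S> g (\<lambda>g1 g2. \<S> b (\<lambda>x y. rtensor (flip3 \<alpha> g1 g2) (pure kA kA y x)))"
  proof -
    have "rtensor (flip3 \<alpha> g1 g2) (pure kA kA y x) = \<S> x (\<lambda>u v. ?f g1 g2 u v y)" for g1 g2 x y
    proof -
      have "rtensor (flip3 \<alpha> g1 g2) (pure kA kA y x) =
          pure kA AdV (g2 * y) (\<S> x (\<lambda>u v. pure kA dV (g1 * v) (\<rho>t u \<alpha>)))"
        by (simp add: \<alpha> tensor_product_map_pure[OF vspaces(1,6,1) A.bilinear_on_mult bilinear_rmult]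
            rmult_pure)
      also have "\<dots> = \<S> x (\<lambda>u v. ?f g1 g2 u v y)"
        by (rule C.linear_sweedler[of AdV "tensor kA AdV" "\<lambda>z. pure kA AdV (g2 * y) z"];
            (rule sw_lin | simp add: \<alpha>)+)
      finally show ?thesis .
    qed
    then show ?thesis by simp
  qed
  also have "\<dots> = rtensor (\<S> g (\<lambda>g1 g2. flip3 \<alpha> g1 g2)) (\<S> b (\<lambda>x y. pure kA kA y x))"
    by (rule C.bilinear_sweedlers[OF vspace_tensor vspace_tensor vspace_tensor bilinear_rtensor
        bilinear_flip3[OF \<alpha>] C.bilinear_swap, symmetric])
  finally show "coact (rmult (pure kA dV g \<alpha>) b) = rtensor (coact (pure kA dV g \<alpha>)) (cop sA \<Delta> b)"
    by (simp add: \<alpha> coact_pure cop_def)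
qed simp

text \<open>The two-sided condition for a.x.b follows by applying the right-hand compatibility to
  a.x and then the left-hand one to x.\<close>

lemma left_covariant_dual: "left_covariant_bimodule sA (cop sA \<Delta>) \<epsilon> dV rmult"
  unfolding left_covariant_bimodule_def left_free_def
  by (simp add: C.bialgebra_cop bimodule_left_free coact_lmul coact_rmult)

end

theorem theorem5p3:
  fixes sV :: "'k::field \<Rightarrow> 'v::ab_group_add \<Rightarrow> 'v" and B :: "'v set"
    and sA :: "'k \<Rightarrow> 'a::{ring,monoid_mult} \<Rightarrow> 'a"
    and \<Lambda> :: "'a \<Rightarrow> (('a \<Rightarrow> ('v \<Rightarrow> 'v) \<Rightarrow> 'k) \<Rightarrow> 'k)"
  assumes V: "finite_dimensional_vector_space sV B"
    and A: "k_algebra sA"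
    and \<Lambda>: "commutation_rule sA (whole sV) \<Lambda>"
  shows
    "let V = whole sV;
         V_A = right_free sA V;
         l = commutation_left_mult sA V \<Lambda>;
         V' = dual_space V;
         A_V' = left_free sA V';
         \<Phi> = transpose_rule sA V \<Lambda>;
         r' = commutation_right_mult sA V' \<Phi>
     in
       (bimodule sA V_A l (right_free_mult sA V) \<and>
        bimodule sA (right_dual sA V_A (right_free_mult sA V))
          right_dual_left_mult (right_dual_right_mult V_A l) \<and>
        right_commutation_rule sA V' \<Phi> \<and>
        bimodule sA A_V' (left_free_mult sA V') r' \<and>
        bimodule_iso A_V' (left_free_mult sA V') r'
          (right_dual sA V_A (right_free_mult sA V))
          right_dual_left_mult (right_dual_right_mult V_A l)
          (dual_pairing sA V) \<and>
        (\<forall>a. \<forall>k\<in>B. r' (pure (whole sA) V' 1 (dual_basis sV B k)) a =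
           (\<Sum>m\<in>B. pure (whole sA) V' (component sV sA B \<Lambda> k m a) (dual_basis sV B m))))
       \<and>
       (\<forall>\<Delta> \<epsilon> \<rho>.
          bialgebra sA \<Delta> \<epsilon> \<and>
          right_covariant_bimodule sA \<Delta> \<epsilon> V l \<and>
          representation sA V \<rho> \<and>
          (\<forall>a. \<Lambda> a = sweedler sA \<Delta> a (\<lambda>a1 a2. pure (whole sA) (End_space V) a2 (\<rho> a1)))
          \<longrightarrow>
          right_module_structure sA V' (\<lambda>a. transpose_map V (\<rho> a)) \<and>
          (\<forall>a b. \<forall>\<alpha>\<in>vcarrier V'. r' (pure (whole sA) V' b \<alpha>) a =
             sweedler sA \<Delta> a (\<lambda>a1 a2. pure (whole sA) V' (b * a2) (transpose_map V (\<rho> a1) \<alpha>))) \<and>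
          (\<forall>b. \<forall>\<alpha>\<in>vcarrier V'. left_coaction sA (cop sA \<Delta>) V' (pure (whole sA) V' b \<alpha>) =
             sweedler sA \<Delta> b (\<lambda>b1 b2.
               pure (whole sA) A_V' b2 (pure (whole sA) V' b1 \<alpha>))) \<and>
          left_covariant_bimodule sA (cop sA \<Delta>) \<epsilon> V' r')"
proof -
  interpret commutation sV B sA \<Lambda>
    using V A \<Lambda> by (simp add: commutation_def commutation_axioms_def dual_bases_over_algebra_def)
  \<comment> \<open>The bialgebra and the representation are quantified inside the goal, so the
    locale that describes them is interpreted only within this block.\<close>
  have cov: "right_module_structure sA dV (\<lambda>a. transpose_map kV (\<rho> a)) \<and>
      (\<forall>a b. \<forall>\<alpha>\<in>vcarrier dV. rmult (pure kA dV b \<alpha>) a =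
         sweedler sA \<Delta> a (\<lambda>a1 a2. pure kA dV (b * a2) (transpose_map kV (\<rho> a1) \<alpha>))) \<and>
      (\<forall>b. \<forall>\<alpha>\<in>vcarrier dV. left_coaction sA (cop sA \<Delta>) dV (pure kA dV b \<alpha>) =
         sweedler sA \<Delta> b (\<lambda>b1 b2. pure kA (tensor kA dV) b2 (pure kA dV b1 \<alpha>))) \<and>
      left_covariant_bimodule sA (cop sA \<Delta>) \<epsilon> dV rmult"
    if "bialgebra sA \<Delta> \<epsilon>" "representation sA kV \<rho>"
      and "\<forall>a. \<Lambda> a = sweedler sA \<Delta> a (\<lambda>a1 a2. pure kA EndV a2 (\<rho> a1))" for \<Delta> \<epsilon> \<rho>
  proof -
    interpret C: bialgebra sA \<Delta> \<epsilon> by (rule that(1))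
    interpret representation_commutation sV B sA \<Lambda> \<Delta> \<epsilon> \<rho>
      by unfold_locales (use that in blast)+
    show ?thesis
      by (simp add: right_module_transpose rmult_pure coact_pure left_covariant_dual)
  qed
  show ?thesis
    unfolding Let_def left_free_def right_free_def
    by (intro conjI allI impI bimodule_right_free bimodule_right_dual right_commutation_rule_transpose
        bimodule_left_free dual_pairing_iso ballI rmult_dual_basis)
      (use cov in blast)+
qed

end
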